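(* In each of the following five subcases, with $\sigma,\tau,\eta$ depending on $t$ exactly as displayed, let $p,q$ be the coefficients of the deformed equation given in the context, and let $a,b,H$ be as specified. Then $\lambda(t),\mu(t)$ satisfy the Hamilton equations $$\frac{d\lambda}{dt}=\frac{\partial H}{\partial\mu}(t,\lambda,\mu),\qquad \frac{d\mu}{dt}=-\frac{\partial H}{\partial\lambda}(t,\lambda,\mu)$$ if and only if the compatibility conditions $$\dot p-ap'+2b'-pa'+a''=0,\qquad \dot q+pb'-2qa'-aq'+b''=0$$ hold. **Subcase A1.** $\sigma(z)=(z-t)\rho(z)$ with $\deg\rho\leq2$; $\tau(z)=(1-\kappa)\rho(z)+\phi(z)(z-t)$ with $\kappa\in\mathbb{C}$, $\deg\phi\leq1$; $\eta(z)=\frac{\alpha\rho(t)}{z-t}+\eta_0(z)$ with $\alpha\in\mathbb{C}$, $\deg\eta_0\leq1$. Assume $\rho(t)\neq0$. Then $$a=\frac{(\lambda-t)\rho(z)}{\rho(t)(z-\lambda)},\qquad b=-\frac{\sigma(\lambda)\mu}{\rho(t)(z-\lambda)},$$ $$\rho(t)H=(\lambda-t)\rho(\lambda)\mu^2+\Big((1-\kappa)\rho(\lambda)+(\lambda-t)\big(\phi(\lambda)-\rho'(\lambda)\big)\Big)\mu+\frac{\alpha\rho(t)}{\lambda-t}+\eta_0(\lambda).$$ **Subcase Ap.** $\sigma(z)=(z-s)^2\rho_1(z)$ with $s\in\mathbb{C}$, $\deg\rho_1\leq1$; $\tau(z)=t\rho_1(z)+\tau_0(z)$ with $\deg\tau_0\leq2$;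 $\eta(z)=\frac{\psi(z)}{\rho_1(z)}$ with $\deg\psi\leq2$. Assume $\tau_0(s)\neq0$ or $\rho_1(s)\neq0$. Then, with $M=\tau_0(s)+t\rho_1(s)$, $$a=\frac{(\lambda-s)(z-s)\rho_1(z)}{M(z-\lambda)},\qquad b=-\frac{(\lambda-s)^2\rho_1(\lambda)\mu}{M(z-\lambda)},$$ $$MH=(\lambda-s)^2\rho_1(\lambda)\mu^2+\Big(t\rho_1(\lambda)+\tau_0(\lambda)-(\lambda-s)\rho_1(\lambda)-(\lambda-s)^2\rho_1'\Big)\mu+\frac{\psi(\lambda)}{\rho_1(\lambda)}.$$ **Subcase Aq.** $\sigma(z)=(z-s)^2\rho_1(z)$ with $s\in\mathbb{C}$, $\deg\rho_1\leq1$; $\tau(z)=(z-s)\phi(z)$ with $\deg\phi\leq1$; $\eta(z)=\frac{t}{z-s}+\eta_0(z)$ with $\deg\rho_1\eta_0\leq2$. Assume $(\sigma\eta_0)'(s)\neq0$ or $\rho_1(s)\neq0$. Then, with $M=(\sigma\eta_0)'(s)+\rho_1(s)t$, $$a=\frac{(\lambda-s)(z-s)\rho_1(z)}{M(z-\lambda)},\qquad b=-\frac{(\lambda-s)^2\rho_1(\lambda)\mu}{M(z-\lambda)},$$ $$MH=(\lambda-s)^2\rho_1(\lambda)\mu^2+\Big((\lambda-s)\big(\phi(\lambda)-\rho_1(\lambda)\big)-(\lambda-s)^2\rho_1'\Big)\mu+\frac{t}{\lambda-s}+\eta_0(\lambda).$$ **Subcase Bp.** $\deg\sigma\leq2$;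 $\tau(z)=t\sigma(z)+\tau_0(z)$ with $\deg\tau_0\leq2$; $\deg\sigma\eta\leq2$. Assume $\sigma''\neq0$ or $\tau_0''\neq0$. Then, with $M=t\frac{\sigma''}{2}+\frac{\tau_0''}{2}$, $$a=\frac{\sigma(z)}{M(z-\lambda)},\qquad b=-\frac{\sigma(\lambda)\mu}{M(z-\lambda)},$$ $$MH=\sigma(\lambda)\mu^2+\big(t\sigma(\lambda)+\tau_0(\lambda)-\sigma'(\lambda)\big)\mu+\eta(\lambda).$$ **Subcase Bq.** $\deg\sigma\leq2$; $\deg\tau\leq1$; $\eta(z)=tz+\eta_0(z)$ with $\deg\sigma\eta_0\leq3$. Assume $\sigma''\neq0$ or $(\sigma\eta_0)'''\neq0$. Then, with $M=t\frac{\sigma''}{2}+\frac{(\sigma\eta_0)'''}{6}$, $$a=\frac{\sigma(z)}{M(z-\lambda)},\qquad b=-\frac{\sigma(\lambda)\mu}{M(z-\lambda)},$$ $$MH=\sigma(\lambda)\mu^2+\big(\tau(\lambda)-\sigma'(\lambda)\big)\mu+t\lambda+\eta_0(\lambda).$$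
   Context: For Heun class coefficients $\sigma\ne0,\tau,\eta$ (functions of $z$ depending on a complex time $t$) and complex $\lambda,\mu$, the deformed equation is $v''+pv'+qv=0$ with $$p=\frac{\tau(z)}{\sigma(z)}-\frac{1}{z-\lambda},\qquad q=\frac{1}{\sigma(z)}\Big(\eta(z)-\eta(\lambda)-\mu\big(\tau(\lambda)-\sigma'(\lambda)\big)-\mu^2\sigma(\lambda)+\frac{\mu\sigma(\lambda)}{z-\lambda}\Big).$$ Writing $\deg\beta\le n$ means that $\beta$ is a polynomial in $z$ of degree $\le n$. The dependence on $t$ is always explicit: the objects $\rho,\phi,\kappa,\alpha,\eta_0$ (A1), $s,\rho_1,\tau_0,\psi$ (Ap), $s,\rho_1,\phi,\eta_0$ (Aq), $\sigma,\tau_0,\eta$ (Bp), $\sigma,\tau,\eta_0$ (Bq) do not depend on $t$; $\sigma$ is never identically zero. In A1, $\rho(t)$ is the value of $\rho$ at $z=t$. In each subcase $t$ ranges over values where $\rho(t)$, respectively $M$, is nonzero. A prime denotes $\partial_z$ (and $f'(\lambda)$ means $f'(z)$ at $z=\lambda$). In the compatibility conditions $\dot p,\dot q$ are the total $t$-derivatives at fixed $z$ of $p,q$ with $\lambda=\lambda(t),\mu=\mu(t)$ substituted, and the conditions are required identically in $z$ and $t$. It is understood that $\lambda(t)$ avoids the zeros of $\sigma$ and the poles of $\eta$. *)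

theory Defs
  imports "HOL-Analysis.Analysis" "HOL-Computational_Algebra.Polynomial"
begin

text \<open>
  Conventions. The time \<open>t\<close> is complex. Time-dependent functions of \<open>z\<close> are curried as
  \<open>f t z\<close>, so a prime (the derivative in \<open>z\<close>) is \<open>deriv (f t) z\<close> and a dot is the derivative
  of \<open>\<lambda>t. f t z\<close>. The arguments \<open>l\<close> and \<open>m\<close> stand for the values of \<open>\<lambda>\<close> and \<open>\<mu>\<close>; the
  functions \<open>\<lambda>(t)\<close>, \<open>\<mu>(t)\<close> themselves are called \<open>lam\<close> and \<open>mu\<close>.
\<close>

subsection \<open>The deformed equation and the two systems of conditions\<close>

definition deformed_p ::
  "(complex \<Rightarrow> complex) \<Rightarrow> (complex \<Rightarrow> complex) \<Rightarrow> complex \<Rightarrow> complex \<Rightarrow> complex" where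
  "deformed_p \<sigma> \<tau> l z = \<tau> z / \<sigma> z - 1 / (z - l)"

definition deformed_q ::
  "(complex \<Rightarrow> complex) \<Rightarrow> (complex \<Rightarrow> complex) \<Rightarrow> (complex \<Rightarrow> complex) \<Rightarrow>
   complex \<Rightarrow> complex \<Rightarrow> complex \<Rightarrow> complex" where
  "deformed_q \<sigma> \<tau> \<eta> l m z =
     1 / \<sigma> z * (\<eta> z - \<eta> l - m * (\<tau> l - deriv \<sigma> l) - m\<^sup>2 * \<sigma> l + m * \<sigma> l / (z - l))"

definition hamilton_equations ::
  "complex set \<Rightarrow> (complex \<Rightarrow> complex \<Rightarrow> complex \<Rightarrow> complex) \<Rightarrow>
   (complex \<Rightarrow> complex) \<Rightarrow> (complex \<Rightarrow> complex) \<Rightarrow> bool" where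
  "hamilton_equations T H lam mu \<longleftrightarrow>
     (\<forall>t\<in>T. deriv lam t = deriv (\<lambda>m. H t (lam t) m) (mu t) \<and>
            deriv mu t = - deriv (\<lambda>l. H t l (mu t)) (lam t))"

text \<open>
  The coefficients \<open>p\<close>, \<open>q\<close>, \<open>a\<close>, \<open>b\<close> are functions of \<open>t\<close> and \<open>z\<close> here, that is, with
  \<open>\<lambda>(t)\<close> and \<open>\<mu>(t)\<close> already substituted. Division by zero yields \<open>0\<close> in HOL, so the
  identities between rational functions of \<open>z\<close> are required on a set \<open>D\<close> of points \<open>(t, z)\<close>
  away from the poles.
\<close>

definition compatibility_conditions ::
  "(complex \<times> complex) set \<Rightarrow>
   (complex \<Rightarrow> complex \<Rightarrow> complex) \<Rightarrow> (complex \<Rightarrow> complex \<Rightarrow> complex) \<Rightarrow>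
   (complex \<Rightarrow> complex \<Rightarrow> complex) \<Rightarrow> (complex \<Rightarrow> complex \<Rightarrow> complex) \<Rightarrow> bool" where
  "compatibility_conditions D p q a b \<longleftrightarrow>
     (\<forall>(t, z)\<in>D.
        deriv (\<lambda>t. p t z) t - a t z * deriv (p t) z + 2 * deriv (b t) z
          - p t z * deriv (a t) z + (deriv ^^ 2) (a t) z = 0 \<and>
        deriv (\<lambda>t. q t z) t + p t z * deriv (b t) z - 2 * q t z * deriv (a t) z
          - a t z * deriv (q t) z + (deriv ^^ 2) (b t) z = 0)"

subsection \<open>The five subcases\<close>

text \<open>
  The product of the polynomial \<open>D\<close> and the rational function \<open>f\<close> is the polynomial \<open>N\<close>. The
  values of \<open>f\<close> at zeros of \<open>D\<close>, where \<open>f\<close> may have a pole, are not constrained.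
  In every subcase the poles of \<open>\<eta>\<close> are among the zeros of \<open>\<sigma>\<close>, so avoiding the latter suffices.
\<close>

definition product_is_poly ::
  "complex poly \<Rightarrow> (complex \<Rightarrow> complex) \<Rightarrow> complex poly \<Rightarrow> bool" where
  "product_is_poly D f N \<longleftrightarrow> (\<forall>z. poly D z \<noteq> 0 \<longrightarrow> poly D z * f z = poly N z)"

definition subcase_A1 ::
  "complex set \<Rightarrow> (complex \<Rightarrow> complex \<Rightarrow> complex) \<Rightarrow> (complex \<Rightarrow> complex \<Rightarrow> complex) \<Rightarrow>
   (complex \<Rightarrow> complex \<Rightarrow> complex) \<Rightarrow> (complex \<Rightarrow> complex \<Rightarrow> complex \<Rightarrow> complex \<Rightarrow> complex) \<Rightarrow>
   (complex \<Rightarrow> complex \<Rightarrow> complex \<Rightarrow> complex \<Rightarrow> complex) \<Rightarrow>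
   (complex \<Rightarrow> complex \<Rightarrow> complex \<Rightarrow> complex) \<Rightarrow> bool" where
  "subcase_A1 T \<sigma> \<tau> \<eta> a b H \<longleftrightarrow>
     (\<exists>\<rho> \<phi> \<eta>0 \<kappa> \<alpha>.
        degree \<rho> \<le> 2 \<and> degree \<phi> \<le> 1 \<and> degree \<eta>0 \<le> 1 \<and>
        (\<forall>t z. \<sigma> t z = (z - t) * poly \<rho> z) \<and>
        (\<forall>t z. \<tau> t z = (1 - \<kappa>) * poly \<rho> z + poly \<phi> z * (z - t)) \<and>
        (\<forall>t z. \<eta> t z = \<alpha> * poly \<rho> t / (z - t) + poly \<eta>0 z) \<and>
        (\<forall>t\<in>T. poly \<rho> t \<noteq> 0) \<and>
        (\<forall>t\<in>T. \<forall>l m z. a t l m z = (l - t) * poly \<rho> z / (poly \<rho> t * (z - l))) \<and>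
        (\<forall>t\<in>T. \<forall>l m z. b t l m z = - (\<sigma> t l * m / (poly \<rho> t * (z - l)))) \<and>
        (\<forall>t\<in>T. \<forall>l m. poly \<rho> t * H t l m =
            (l - t) * poly \<rho> l * m\<^sup>2
            + ((1 - \<kappa>) * poly \<rho> l + (l - t) * (poly \<phi> l - poly (pderiv \<rho>) l)) * m
            + \<alpha> * poly \<rho> t / (l - t) + poly \<eta>0 l))"

definition subcase_Ap ::
  "complex set \<Rightarrow> (complex \<Rightarrow> complex \<Rightarrow> complex) \<Rightarrow> (complex \<Rightarrow> complex \<Rightarrow> complex) \<Rightarrow>
   (complex \<Rightarrow> complex \<Rightarrow> complex) \<Rightarrow> (complex \<Rightarrow> complex \<Rightarrow> complex \<Rightarrow> complex \<Rightarrow> complex) \<Rightarrow>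
   (complex \<Rightarrow> complex \<Rightarrow> complex \<Rightarrow> complex \<Rightarrow> complex) \<Rightarrow>
   (complex \<Rightarrow> complex \<Rightarrow> complex \<Rightarrow> complex) \<Rightarrow> bool" where
  "subcase_Ap T \<sigma> \<tau> \<eta> a b H \<longleftrightarrow>
     (\<exists>s \<rho>1 \<tau>0 \<psi> M.
        \<rho>1 \<noteq> 0 \<and> degree \<rho>1 \<le> 1 \<and> degree \<tau>0 \<le> 2 \<and> degree \<psi> \<le> 2 \<and>
        (\<forall>t z. \<sigma> t z = (z - s)\<^sup>2 * poly \<rho>1 z) \<and>
        (\<forall>t z. \<tau> t z = t * poly \<rho>1 z + poly \<tau>0 z) \<and>
        (\<forall>t z. \<eta> t z = poly \<psi> z / poly \<rho>1 z) \<and>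
        (poly \<tau>0 s \<noteq> 0 \<or> poly \<rho>1 s \<noteq> 0) \<and>
        (\<forall>t. M t = poly \<tau>0 s + t * poly \<rho>1 s) \<and>
        (\<forall>t\<in>T. M t \<noteq> 0) \<and>
        (\<forall>t\<in>T. \<forall>l m z. a t l m z = (l - s) * (z - s) * poly \<rho>1 z / (M t * (z - l))) \<and>
        (\<forall>t\<in>T. \<forall>l m z. b t l m z = - ((l - s)\<^sup>2 * poly \<rho>1 l * m / (M t * (z - l)))) \<and>
        (\<forall>t\<in>T. \<forall>l m. M t * H t l m =
            (l - s)\<^sup>2 * poly \<rho>1 l * m\<^sup>2
            + (t * poly \<rho>1 l + poly \<tau>0 l - (l - s) * poly \<rho>1 l
                - (l - s)\<^sup>2 * poly (pderiv \<rho>1) l) * m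
            + poly \<psi> l / poly \<rho>1 l))"

text \<open>
  In the next definition \<open>R\<close> is the polynomial \<open>\<rho>\<^sub>1 \<eta>\<^sub>0\<close> and \<open>S\<close> is the polynomial \<open>\<sigma> \<eta>\<^sub>0\<close>.
\<close>

definition subcase_Aq ::
  "complex set \<Rightarrow> (complex \<Rightarrow> complex \<Rightarrow> complex) \<Rightarrow> (complex \<Rightarrow> complex \<Rightarrow> complex) \<Rightarrow>
   (complex \<Rightarrow> complex \<Rightarrow> complex) \<Rightarrow> (complex \<Rightarrow> complex \<Rightarrow> complex \<Rightarrow> complex \<Rightarrow> complex) \<Rightarrow>
   (complex \<Rightarrow> complex \<Rightarrow> complex \<Rightarrow> complex \<Rightarrow> complex) \<Rightarrow>
   (complex \<Rightarrow> complex \<Rightarrow> complex \<Rightarrow> complex) \<Rightarrow> bool" where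
  "subcase_Aq T \<sigma> \<tau> \<eta> a b H \<longleftrightarrow>
     (\<exists>s \<rho>1 \<phi> \<eta>0 R S M.
        \<rho>1 \<noteq> 0 \<and> degree \<rho>1 \<le> 1 \<and> degree \<phi> \<le> 1 \<and>
        product_is_poly \<rho>1 \<eta>0 R \<and> degree R \<le> 2 \<and>
        product_is_poly ([:- s, 1:]\<^sup>2 * \<rho>1) \<eta>0 S \<and>
        (\<forall>t z. \<sigma> t z = (z - s)\<^sup>2 * poly \<rho>1 z) \<and>
        (\<forall>t z. \<tau> t z = (z - s) * poly \<phi> z) \<and>
        (\<forall>t z. \<eta> t z = t / (z - s) + \<eta>0 z) \<and>
        (poly (pderiv S) s \<noteq> 0 \<or> poly \<rho>1 s \<noteq> 0) \<and>
        (\<forall>t. M t = poly (pderiv S) s + poly \<rho>1 s * t) \<and>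
        (\<forall>t\<in>T. M t \<noteq> 0) \<and>
        (\<forall>t\<in>T. \<forall>l m z. a t l m z = (l - s) * (z - s) * poly \<rho>1 z / (M t * (z - l))) \<and>
        (\<forall>t\<in>T. \<forall>l m z. b t l m z = - ((l - s)\<^sup>2 * poly \<rho>1 l * m / (M t * (z - l)))) \<and>
        (\<forall>t\<in>T. \<forall>l m. M t * H t l m =
            (l - s)\<^sup>2 * poly \<rho>1 l * m\<^sup>2
            + ((l - s) * (poly \<phi> l - poly \<rho>1 l) - (l - s)\<^sup>2 * poly (pderiv \<rho>1) l) * m
            + t / (l - s) + \<eta>0 l))"

text \<open>
  In the last two subcases the second, respectively third, derivatives are those of polynomials
  of degree at most \<open>2\<close>, respectively \<open>3\<close>; they are constant, and \<open>M\<close> evaluates them at \<open>0\<close>.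
  The polynomial \<open>N\<close> is \<open>\<sigma> \<eta>\<close>, respectively \<open>\<sigma> \<eta>\<^sub>0\<close>.
\<close>

definition subcase_Bp ::
  "complex set \<Rightarrow> (complex \<Rightarrow> complex \<Rightarrow> complex) \<Rightarrow> (complex \<Rightarrow> complex \<Rightarrow> complex) \<Rightarrow>
   (complex \<Rightarrow> complex \<Rightarrow> complex) \<Rightarrow> (complex \<Rightarrow> complex \<Rightarrow> complex \<Rightarrow> complex \<Rightarrow> complex) \<Rightarrow>
   (complex \<Rightarrow> complex \<Rightarrow> complex \<Rightarrow> complex \<Rightarrow> complex) \<Rightarrow>
   (complex \<Rightarrow> complex \<Rightarrow> complex \<Rightarrow> complex) \<Rightarrow> bool" where
  "subcase_Bp T \<sigma> \<tau> \<eta> a b H \<longleftrightarrow>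
     (\<exists>\<sigma>0 \<tau>0 \<eta>0 N M.
        \<sigma>0 \<noteq> 0 \<and> degree \<sigma>0 \<le> 2 \<and> degree \<tau>0 \<le> 2 \<and>
        product_is_poly \<sigma>0 \<eta>0 N \<and> degree N \<le> 2 \<and>
        (\<forall>t z. \<sigma> t z = poly \<sigma>0 z) \<and>
        (\<forall>t z. \<tau> t z = t * poly \<sigma>0 z + poly \<tau>0 z) \<and>
        (\<forall>t z. \<eta> t z = \<eta>0 z) \<and>
        ((pderiv ^^ 2) \<sigma>0 \<noteq> 0 \<or> (pderiv ^^ 2) \<tau>0 \<noteq> 0) \<and>
        (\<forall>t. M t = t * poly ((pderiv ^^ 2) \<sigma>0) 0 / 2 + poly ((pderiv ^^ 2) \<tau>0) 0 / 2) \<and>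
        (\<forall>t\<in>T. M t \<noteq> 0) \<and>
        (\<forall>t\<in>T. \<forall>l m z. a t l m z = poly \<sigma>0 z / (M t * (z - l))) \<and>
        (\<forall>t\<in>T. \<forall>l m z. b t l m z = - (poly \<sigma>0 l * m / (M t * (z - l)))) \<and>
        (\<forall>t\<in>T. \<forall>l m. M t * H t l m =
            poly \<sigma>0 l * m\<^sup>2
            + (t * poly \<sigma>0 l + poly \<tau>0 l - poly (pderiv \<sigma>0) l) * m + \<eta>0 l))"

definition subcase_Bq ::
  "complex set \<Rightarrow> (complex \<Rightarrow> complex \<Rightarrow> complex) \<Rightarrow> (complex \<Rightarrow> complex \<Rightarrow> complex) \<Rightarrow>
   (complex \<Rightarrow> complex \<Rightarrow> complex) \<Rightarrow> (complex \<Rightarrow> complex \<Rightarrow> complex \<Rightarrow> complex \<Rightarrow> complex) \<Rightarrow>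
   (complex \<Rightarrow> complex \<Rightarrow> complex \<Rightarrow> complex \<Rightarrow> complex) \<Rightarrow>
   (complex \<Rightarrow> complex \<Rightarrow> complex \<Rightarrow> complex) \<Rightarrow> bool" where
  "subcase_Bq T \<sigma> \<tau> \<eta> a b H \<longleftrightarrow>
     (\<exists>\<sigma>0 \<tau>0 \<eta>0 N M.
        \<sigma>0 \<noteq> 0 \<and> degree \<sigma>0 \<le> 2 \<and> degree \<tau>0 \<le> 1 \<and>
        product_is_poly \<sigma>0 \<eta>0 N \<and> degree N \<le> 3 \<and>
        (\<forall>t z. \<sigma> t z = poly \<sigma>0 z) \<and>
        (\<forall>t z. \<tau> t z = poly \<tau>0 z) \<and>
        (\<forall>t z. \<eta> t z = t * z + \<eta>0 z) \<and>
        ((pderiv ^^ 2) \<sigma>0 \<noteq> 0 \<or> (pderiv ^^ 3) N \<noteq> 0) \<and>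
        (\<forall>t. M t = t * poly ((pderiv ^^ 2) \<sigma>0) 0 / 2 + poly ((pderiv ^^ 3) N) 0 / 6) \<and>
        (\<forall>t\<in>T. M t \<noteq> 0) \<and>
        (\<forall>t\<in>T. \<forall>l m z. a t l m z = poly \<sigma>0 z / (M t * (z - l))) \<and>
        (\<forall>t\<in>T. \<forall>l m z. b t l m z = - (poly \<sigma>0 l * m / (M t * (z - l)))) \<and>
        (\<forall>t\<in>T. \<forall>l m. M t * H t l m =
            poly \<sigma>0 l * m\<^sup>2
            + (poly \<tau>0 l - poly (pderiv \<sigma>0) l) * m + t * l + \<eta>0 l))"

end

theory Submission
  imports Defs
begin

text \<open>
  In all five subcases the data have the same shape. There are a nonzero number \<open>M\<close> depending on
  \<open>t\<close> and a polynomial \<open>G\<close> in \<open>z\<close> with \<open>G(\<lambda>) = \<sigma>(\<lambda>)\<close> such that \<open>a = G(z) / (M (z - \<lambda>))\<close>,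
  \<open>b = - \<sigma>(\<lambda>) \<mu> / (M (z - \<lambda>))\<close> and \<open>M H = \<sigma>(\<lambda>) \<mu>\<^sup>2 + (\<tau>(\<lambda>) - h(\<lambda>)) \<mu> + \<eta>(\<lambda>)\<close>, where \<open>h(\<lambda>)\<close> is
  the value at \<open>z = \<lambda>\<close> of the \<open>z\<close>-derivative of \<open>G\<close>. Both systems are conditions at each time
  separately, so \<open>t\<close> can be fixed; write \<open>w = 1 / (z - \<lambda>)\<close>.

  The first compatibility condition is linear in \<open>\<lambda>'\<close>, which enters only through the double pole
  of \<open>p\<close> at \<open>z = \<lambda>\<close>. Its left-hand side equals \<open>(\<partial>H/\<partial>\<mu> - \<lambda>') w\<^sup>2\<close>, provided that everything
  except the double pole cancels (first_condition_reduces). That cancellation does not involve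
  \<open>\<mu>\<close>; it prescribes how \<open>\<tau>/\<sigma>\<close> moves with \<open>t\<close>. So the first condition is the first Hamilton
  equation.

  Once \<open>\<lambda>' = \<partial>H/\<partial>\<mu>\<close> is known, the left-hand side of the second condition, multiplied by \<open>\<sigma>(z)\<close>,
  is \<open>(\<sigma>(\<lambda>) w - \<kappa>) (\<mu>' + \<partial>H/\<partial>\<lambda>)\<close> with \<open>\<kappa> = \<tau>(\<lambda>) - \<sigma>'(\<lambda>) + 2 \<mu> \<sigma>(\<lambda>)\<close>, up to a remainder that is a
  polynomial of degree two in \<open>\<mu>\<close> and whose three coefficients have to vanish
  (second_condition_reduces). As \<open>\<sigma>(\<lambda>) \<noteq> 0\<close>, the factor \<open>\<sigma>(\<lambda>) w - \<kappa>\<close> is nonzero at some \<open>z\<close>, and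
  the second condition is the second Hamilton equation.

  It remains to verify four identities that no longer contain \<open>\<mu>\<close>, \<open>\<lambda>'\<close>, \<open>\<mu>'\<close>: one for the first
  condition and the coefficients of \<open>\<mu>\<^sup>0\<close>, \<open>\<mu>\<^sup>1\<close>, \<open>\<mu>\<^sup>2\<close> for the second. Expanding the
  polynomials around \<open>\<lambda>\<close> makes each of them a short computation, and two computations cover the
  five subcases. In Bp and Bq the moving parameter sits at infinity: \<open>G = \<sigma>\<close>, and the motion in
  \<open>t\<close> is controlled by the leading coefficients of \<open>\<tau>\<close> and \<open>\<sigma> \<eta>\<close>. In A1, Ap and Aq it sits at a
  finite zero \<open>s\<close> of \<open>\<sigma> = (z - s) \<rho>\<close>: \<open>G = (\<lambda> - s) \<rho>\<close>, and the motion is controlled by the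
  values of \<open>\<rho>\<close>, \<open>\<rho>'\<close>, \<open>\<tau>\<close> at \<open>s\<close> and by the residue of \<open>\<eta>\<close> there. A1 is the case \<open>s = t\<close>; in Ap
  and Aq the zero \<open>s\<close> is multiple, that is \<open>\<rho>(s) = 0\<close>.
\<close>

section \<open>Rational functions with a polynomial denominator\<close>

text \<open>
  Away from the zeros of \<open>D\<close> the function \<open>f\<close> coincides near \<open>z\<close> with \<open>N / D\<close>; its values at the
  zeros of \<open>D\<close> are arbitrary, so the equality is only local.
\<close>

lemma product_is_poly_deriv:
  assumes f: "product_is_poly D f N" and z: "poly D z \<noteq> 0"
  shows "(f has_field_derivative (poly (pderiv N) z - poly (pderiv D) z * f z) / poly D z) (at z)"
proof -
  have nz: "\<forall>\<^sub>F x in nhds z. poly D x \<noteq> 0"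
    using z by (intro tendsto_imp_eventually_ne[where c = "poly D z"] tendsto_intros filterlim_ident)
  have N: "poly N z = poly D z * f z"
    using z f by (simp add: product_is_poly_def)
  have "((\<lambda>x. poly N x / poly D x) has_field_derivative
     (poly (pderiv N) z - poly (pderiv D) z * f z) / poly D z) (at z)"
    by (rule DERIV_cong[OF DERIV_divide[OF poly_DERIV poly_DERIV z]])
       (use z in \<open>simp add: N field_simps\<close>)
  moreover have ev: "\<forall>\<^sub>F x in nhds z. poly N x / poly D x = f x"
    using nz by eventually_elim (use f in \<open>simp add: product_is_poly_def nonzero_divide_eq_eq mult.commute\<close>)
  ultimately show ?thesis
    using DERIV_cong_ev[OF refl ev refl] by simp
qed

lemma product_is_poly_product_rule:
  assumes f: "product_is_poly D f N" and z: "poly D z \<noteq> 0"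
    and f': "(f has_field_derivative f') (at z)"
  shows "poly D z * f' + poly (pderiv D) z * f z = poly (pderiv N) z"
  using DERIV_unique[OF f' product_is_poly_deriv[OF f z]] z by simp

text \<open>
  The two products agree off the finitely many zeros of \<open>E * D\<close>, hence as polynomials.
\<close>

lemma product_is_poly_factor:
  assumes "product_is_poly (E * D) f N" "product_is_poly D f R" "E * D \<noteq> 0"
  shows "N = E * R"
proof -
  have "poly ((N - E * R) * (E * D)) z = 0" for z
  proof (cases "poly (E * D) z = 0")
    case False
    then have nz: "poly E z \<noteq> 0" "poly D z \<noteq> 0" by auto
    have "poly N z = poly E z * poly D z * f z" "poly D z * f z = poly R z"
      using assms(1,2) nz by (simp_all add: product_is_poly_def)
    then have "poly N z = poly E z * poly R z" by (simp add: mult.assoc)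
    then show ?thesis by simp
  qed (simp only: poly_mult mult_zero_right)
  then have "(N - E * R) * (E * D) = 0"
    using poly_all_0_iff_0 by blast
  then show ?thesis using assms(3) by simp
qed

section \<open>Joint differentiability in time and position\<close>

text \<open>
  Joint differentiability in \<open>(t, z)\<close>, and not mere existence of the two partial derivatives, is
  what the chain rule along \<open>z = \<lambda>(t)\<close> needs.
\<close>

definition has_partials ::
  "(complex \<Rightarrow> complex \<Rightarrow> complex) \<Rightarrow> complex \<Rightarrow> complex \<Rightarrow> complex \<Rightarrow> complex \<Rightarrow> bool" where
  "has_partials f ft fz t z \<longleftrightarrow>
     ((\<lambda>x. f (fst x) (snd x)) has_derivative (\<lambda>h. ft * fst h + fz * snd h)) (at (t, z))"

lemma has_partials_curve:
  assumes f: "has_partials f ft fz t (c t)" and c: "(c has_field_derivative c') (at t)"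
  shows "((\<lambda>u. f u (c u)) has_field_derivative ft + fz * c') (at t)"
proof -
  have "((\<lambda>u. (u, c u)) has_derivative (\<lambda>h. (h, c' * h))) (at t)"
    using c unfolding has_field_derivative_def by (intro derivative_eq_intros) auto
  note * = has_derivative_compose[OF this f[unfolded has_partials_def]]
  show ?thesis
    unfolding has_field_derivative_def
    by (rule has_derivative_eq_rhs[OF *[simplified]]) (auto simp: fun_eq_iff algebra_simps)
qed

lemma has_partials_fixed_z:
  assumes "has_partials f ft fz t z"
  shows "((\<lambda>u. f u z) has_field_derivative ft) (at t)"
  using has_partials_curve[of f ft fz t "\<lambda>_. z" 0] assms by simp

lemma has_partials_fixed_t:
  assumes "has_partials f ft fz t z"
  shows "(f t has_field_derivative fz) (at z)"
proof -
  have "((\<lambda>v. (t, v)) has_derivative (\<lambda>h. (0, h))) (at z)"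
    by (intro derivative_eq_intros) auto
  note * = has_derivative_compose[OF this assms[unfolded has_partials_def]]
  show ?thesis
    unfolding has_field_derivative_def
    by (rule has_derivative_eq_rhs[OF *[simplified]]) (auto simp: fun_eq_iff algebra_simps)
qed

lemma has_partials_of_z:
  assumes "(f has_field_derivative f') (at z)"
  shows "has_partials (\<lambda>_. f) 0 f' t z"
proof -
  have "(snd has_derivative snd) (at (t, z))" by (rule has_derivative_snd[OF has_derivative_ident])
  from has_derivative_compose[OF this, of f "(*) f'"]
  show ?thesis
    using assms unfolding has_partials_def has_field_derivative_def by simp
qed

lemma has_partials_of_t:
  assumes "(f has_field_derivative f') (at t)"
  shows "has_partials (\<lambda>u _. f u) f' 0 t z"
proof -
  have "(fst has_derivative fst) (at (t, z))" by (rule has_derivative_fst[OF has_derivative_ident])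
  from has_derivative_compose[OF this, of f "(*) f'"]
  show ?thesis
    using assms unfolding has_partials_def has_field_derivative_def by simp
qed

lemma has_partials_add:
  assumes "has_partials f ft fz t z" "has_partials g gt gz t z"
  shows "has_partials (\<lambda>u v. f u v + g u v) (ft + gt) (fz + gz) t z"
  unfolding has_partials_def
  by (rule has_derivative_eq_rhs[OF has_derivative_add[OF assms[unfolded has_partials_def]]])
     (auto simp: algebra_simps)

lemma has_partials_mult:
  assumes "has_partials f ft fz t z" "has_partials g gt gz t z"
  shows "has_partials (\<lambda>u v. f u v * g u v) (ft * g t z + f t z * gt) (fz * g t z + f t z * gz) t z"
  unfolding has_partials_def
  by (rule has_derivative_eq_rhs[OF has_derivative_mult[OF assms[unfolded has_partials_def]]])
     (auto simp: algebra_simps)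

lemma has_partials_cong:
  assumes "has_partials f ft fz t z" "\<And>u v. f u v = g u v" "ft = gt" "fz = gz"
  shows "has_partials g gt gz t z"
proof -
  have "f = g" using assms(2) by auto
  then show ?thesis using assms by simp
qed

lemmas has_partials_poly = has_partials_of_z[OF poly_DERIV]
lemmas has_partials_time = has_partials_of_t[OF DERIV_ident]

lemma has_partials_moving_pole:
  assumes "z \<noteq> t"
  shows "has_partials (\<lambda>u v. 1 / (v - u)) (1 / (z - t)\<^sup>2) (- (1 / (z - t)\<^sup>2)) t z"
proof -
  have "((\<lambda>x. snd x - fst x) has_derivative (\<lambda>h. snd h - fst h)) (at (t, z))"
    by (intro derivative_intros)
  moreover have "((\<lambda>w. 1 / w) has_derivative (*) (- (1 / (z - t)\<^sup>2))) (at (snd (t, z) - fst (t, z)))"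
    using assms unfolding has_field_derivative_def[symmetric]
    by (auto intro!: derivative_eq_intros simp: power2_eq_square)
  ultimately have "((\<lambda>x. 1 / (snd x - fst x)) has_derivative
     (\<lambda>h. (- (1 / (z - t)\<^sup>2)) * (snd h - fst h))) (at (t, z))"
    by (rule has_derivative_compose)
  then show ?thesis
    unfolding has_partials_def by (rule has_derivative_eq_rhs)
        (auto simp: fun_eq_iff algebra_simps diff_divide_distrib)
qed

section \<open>Algebra of the two compatibility conditions\<close>

text \<open>
  In the next two lemmas every value is a separate number: \<open>w\<close>, \<open>i\<close>, \<open>j\<close> are the reciprocals of
  \<open>z - \<lambda>\<close>, \<open>\<sigma>(z)\<close>, \<open>M\<close>; the letters \<open>s\<close>, \<open>\<tau>\<close>, \<open>e\<close> stand for the values of \<open>\<sigma>\<close>, \<open>\<tau>\<close>, \<open>\<eta>\<close> at \<open>z\<close>,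
  and \<open>s0\<close>, \<open>t0\<close>, \<open>e0\<close> for those at \<open>\<lambda>\<close>; an appended \<open>t\<close> or \<open>z\<close> denotes a partial derivative,
  and \<open>G1\<close>, \<open>G2\<close> are the first two derivatives of \<open>G\<close> at \<open>z\<close>.
  The first condition is \<open>p\<^sub>t = (p a - 2 b - a')'\<close>. In \<open>p a - a'\<close> the double poles at \<open>\<lambda>\<close> coming
  from \<open>- a w\<close> and \<open>- a'\<close> cancel, so that at \<open>\<lambda>\<close> only the derivative of a simple pole is left;
  its residue is \<open>\<partial>H/\<partial>\<mu>\<close>.
\<close>

lemma first_condition_reduces:
  fixes M :: complex
  assumes M: "M * j = 1"
   and pole_cancels: "M * (tt * i - \<tau> * st * i^2) = (tz * G * i + \<tau> * G1 * i - \<tau> * G * sz * i^2 - G2) * w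
       - (\<tau> * G * i - G1 - t0 + h) * w^2"
  shows "(tt * i - \<tau> * st * i^2 - l' * w^2) - (G * j * w) * ((tz * i - \<tau> * sz * i^2) + w^2)
      + 2 * (s0 * m * j * w^2)
     - (\<tau> * i - w) * (j * (G1 * w - G * w^2)) + j * (G2 * w - 2 * G1 * w^2 + 2 * G * w^3)
     = (j * (2 * s0 * m + t0 - h) - l') * w^2" (is "?L = ?R")
proof -
  have "M * (?L - ?R) = (M * j-1) * (- (G * w) * ((tz * i - \<tau> * sz * i^2) + w^2) + 2 * (s0 * m * w^2)
     - (\<tau> * i - w) * ((G1 * w - G * w^2)) + (G2 * w - 2 * G1 * w^2 + 2 * G * w^3) - (2 * s0 * m + t0 - h)
         * w^2) + (M * (tt * i - \<tau> * st * i^2) -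
         ((tz * G * i + \<tau> * G1 * i - \<tau> * G * sz * i^2 - G2) * w - (\<tau> * G * i - G1 - t0 + h) * w^2))"
    by algebra
  also have "\<dots> = 0" using M pole_cancels by simp
  finally show ?thesis using M by auto
qed

text \<open>
  With \<open>M \<lambda>'\<close> replaced by \<open>M \<partial>H/\<partial>\<mu>\<close>, the difference of both sides is a polynomial in \<open>\<mu>\<close>. Its
  cubic coefficient vanishes identically, and the other three are the assumptions \<open>eta\<close>, \<open>tau\<close>
  and \<open>sigma\<close>: \<open>\<eta>\<close> occurs only in the first, and neither \<open>\<eta>\<close> nor \<open>\<tau>\<close> in the last. The products
  of two values of \<open>\<tau>\<close> and its derivative in \<open>tau\<close> cancel, so that it is affine in \<open>\<tau>\<close>.
\<close>

lemma second_condition_reduces: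
  fixes M :: complex
  assumes M: "M * j = 1" and s: "s * i = 1"
   and l': "M * l' = 2 * s0 * m + t0 - h"
   and eta: "M * (et - e0t) + (h-s0z) * e0z - s0 * e0z * w - M * (e-e0) * st * i - 2 * (e-e0) * G1 * w
       + 2 * (e-e0) * G * w^2 - G * w * ez + (e-e0) * w * G * i * sz = 0"
   and Q1: "Q1 = s0 * w - (t0 - s0z)"
   and tau: " - M * (t0t - s0zt) - (t0-h) * (t0z-s0zz) + (t0z-h') * (t0-s0z)
       + w * (s0t * M + s0z * (t0-h) -(t0z-h') * s0) + s0 * (t0-h) * w^2 - M * Q1 * st * i + s0 * \<tau> * w^2
       - 3 * s * s0 * w^3 - 2 * Q1 * G1 * w + 2 * Q1 * G * w^2+G * s0 * w^3 + Q1 * w * G * i * sz=0"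
   and sigma: "- M * s0t + (h - s0z) * s0z + 2 * s0 * (s0zz - h') + w * s0 * s0z + 2 * s0^2 * w^2
       + M * s0 * st * i + 2 * s0 * G1 * w - 2 * s0 * G * w^2 - s0 * w * G * i * sz = 0"
   and Q: "Q = e - e0 - m * (t0 - s0z) - m^2 * s0 + m * s0 * w"
   and dQ: "dQ = et - (e0t + e0z * l') - (m' * (t0 - s0z) + m * ((t0t + t0z * l') - (s0zt + s0zz * l')))
       - (2 * m * m' * s0 + m^2 * (s0t + s0z * l'))
      + ((m' * s0 + m * (s0t + s0z * l')) * w + m * s0 * l' * w^2)"
  shows "s * ((dQ * i - Q * st * i^2) + (\<tau> * i - w) * (s0 * m * j * w^2)
      - 2 * (Q * i) * (j * (G1 * w - G * w^2))
     - (G * j * w) * ((ez - m * s0 * w^2) * i - Q * sz * i^2) + -2 * s0 * m * j * w^3)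
     = (s0 * w - (t0 - s0z + 2 * m * s0)) * (m' + j * (s0z * m^2 + (t0z - h') * m + e0z))" (is "s * ?L = ?R")
proof -
  \<comment> \<open>Both sides are \<open>j\<close> times a polynomial in \<open>\<mu>\<close>, so \<open>j\<close> can be dropped from the comparison.\<close>
  define P where "P = M * (dQ - Q * st * i) + (\<tau> - s * w) * (s0 * m * w^2) - 2 * Q * (G1 * w - G * w^2)
      - G * w * (ez - m * s0 * w^2 - Q * sz * i) -2 * s * s0 * m * w^3"
  have "s * ?L = j * P"
    unfolding P_def using M s by algebra
  define R where "R = (s0 * w - (t0 - s0z + 2 * m * s0)) * (M * m' + (s0z * m^2 + (t0z - h') * m + e0z))"
  have "?R = j * R" unfolding R_def using M by algebra
  \<comment> \<open>Regrouped so that \<open>\<lambda>'\<close> occurs only as \<open>M * l'\<close>, which \<open>l'\<close> turns into a polynomial.\<close>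
  have dQ': "M * dQ = M * (et - e0t) - e0z * (M * l')
      - (M * m' * (t0 - s0z) + m * (M * (t0t - s0zt) + (t0z-s0zz) * (M * l'))) -
      (2 * m * (M * m') * s0 + m^2 * (M * s0t + s0z * (M * l')))
      + ((M * m' * s0 + m * (M * s0t + s0z * (M * l'))) * w + m * s0 * (M * l') * w^2)"
    unfolding dQ by algebra
  have Q': "Q = (e-e0) + m * Q1 - m^2 * s0" unfolding Q Q1 by algebra
  have "P - R = (M * (et - e0t) + (h-s0z) * e0z - s0 * e0z * w - M * (e-e0) * st * i - 2 * (e-e0) * G1 * w
      + 2 * (e-e0) * G * w^2 - G * w * ez + (e-e0) * w * G * i * sz)
    + m * (- M * (t0t - s0zt) - (t0-h) * (t0z-s0zz) + (t0z-h') * (t0-s0z) + w *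
        (s0t * M + s0z * (t0-h) -(t0z-h') * s0) + s0 * (t0-h) * w^2 - M * Q1 * st * i + s0 * \<tau> * w^2 - 3 *
        s * s0 * w^3 - 2 * Q1 * G1 * w + 2 * Q1 * G * w^2+G * s0 * w^3 + Q1 * w * G * i * sz)
    + m^2 * (- M * s0t + (h - s0z) * s0z + 2 * s0 * (s0zz - h') + w * s0 * s0z + 2 * s0^2 * w^2 + M * s0 *
        st * i + 2 * s0 * G1 * w - 2 * s0 * G * w^2 - s0 * w * G * i * sz)"
    unfolding P_def R_def right_diff_distrib[of M] dQ' l' Q' Q1 by algebra
  also have "\<dots> = 0" unfolding eta tau sigma by simp
  finally have "P = R" by simp
  then show ?thesis using \<open>s * ?L = j * P\<close> \<open>?R = j * R\<close> by simp
qed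

section \<open>Hamilton equations and compatibility at a fixed time\<close>

abbreviation hamilton_iff_compatible_at where
  "hamilton_iff_compatible_at \<sigma> \<tau> \<eta> a b H lam mu t \<equiv>
     (hamilton_equations {t} H lam mu \<longleftrightarrow>
      compatibility_conditions ({t} \<times> {z. \<sigma> t z \<noteq> 0 \<and> z \<noteq> lam t})
        (\<lambda>t. deformed_p (\<sigma> t) (\<tau> t) (lam t))
        (\<lambda>t. deformed_q (\<sigma> t) (\<tau> t) (\<eta> t) (lam t) (mu t))
        (\<lambda>t. a t (lam t) (mu t))
        (\<lambda>t. b t (lam t) (mu t)))"

text \<open>
  The common shape of the five subcases at one time \<open>t\<close>. Only the values at that time are
  assumed to be polynomial: \<open>S\<close> and \<open>P\<close> are \<open>\<sigma>\<close> and \<open>\<tau>\<close>, and \<open>St\<close> and \<open>Pt\<close> their time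
  derivatives. The coefficient \<open>q\<close> contains \<open>\<sigma>'(\<lambda>)\<close>, so its time derivative requires the partial
  derivatives of \<open>\<sigma>'\<close> as well. The polynomial \<open>h\<close> in \<open>\<lambda>\<close> is needed next to \<open>G\<close>, since \<open>G\<close> may
  itself depend on \<open>\<lambda>\<close>.
\<close>

locale deformation_at =
  fixes \<sigma> \<tau> \<eta> :: "complex \<Rightarrow> complex \<Rightarrow> complex"
    and a b :: "complex \<Rightarrow> complex \<Rightarrow> complex \<Rightarrow> complex \<Rightarrow> complex"
    and H :: "complex \<Rightarrow> complex \<Rightarrow> complex \<Rightarrow> complex"
    and lam mu :: "complex \<Rightarrow> complex"
    and t M :: complex
    and S St P Pt G h :: "complex poly"
    and \<eta>t \<eta>z :: "complex \<Rightarrow> complex"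
  assumes lam: "lam field_differentiable at t" and mu: "mu field_differentiable at t"
    and M: "M \<noteq> 0"
    and \<sigma>_nz: "\<sigma> t (lam t) \<noteq> 0"
    and \<sigma>_eq: "\<And>z. \<sigma> t z = poly S z"
    and \<sigma>: "\<And>z. has_partials \<sigma> (poly St z) (poly (pderiv S) z) t z"
    and \<sigma>': "has_partials (\<lambda>u. deriv (\<sigma> u)) (poly (pderiv St) (lam t))
              (poly (pderiv (pderiv S)) (lam t)) t (lam t)"
    and \<tau>_eq: "\<And>z. \<tau> t z = poly P z"
    and \<tau>: "\<And>z. has_partials \<tau> (poly Pt z) (poly (pderiv P) z) t z"
    and \<eta>: "\<And>z. \<sigma> t z \<noteq> 0 \<Longrightarrow> has_partials \<eta> (\<eta>t z) (\<eta>z z) t z"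
    and a: "\<And>z. a t (lam t) (mu t) z = poly G z / (M * (z - lam t))"
    and b: "\<And>z. b t (lam t) (mu t) z = - (\<sigma> t (lam t) * mu t / (M * (z - lam t)))"
    and h: "poly h (lam t) = poly (pderiv G) (lam t)"
    and H: "\<And>l m. M * H t l m = \<sigma> t l * m\<^sup>2 + (\<tau> t l - poly h l) * m + \<eta> t l"
begin

abbreviation "l0 \<equiv> lam t"
abbreviation "m0 \<equiv> mu t"
abbreviation "l' \<equiv> deriv lam t"
abbreviation "m' \<equiv> deriv mu t"

definition "dH_dmu = (2 * poly S l0 * m0 + poly P l0 - poly h l0) / M"
definition "dH_dlam = (poly (pderiv S) l0 * m0\<^sup>2 + (poly (pderiv P) l0 - poly (pderiv h) l0) * m0 + \<eta>z l0) / M"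

lemma lam': "(lam has_field_derivative l') (at t)" and mu': "(mu has_field_derivative m') (at t)"
  using lam mu by (simp_all add: field_differentiable_derivI)

lemma H_eq: "H t l m = (poly S l * m\<^sup>2 + (poly P l - poly h l) * m + \<eta> t l) / M"
  using H[of l m] M by (simp add: \<sigma>_eq \<tau>_eq field_simps)

lemma deriv_H_mu: "deriv (\<lambda>m. H t l0 m) m0 = dH_dmu"
  unfolding H_eq dH_dmu_def
  by (rule DERIV_imp_deriv) (use M in \<open>auto intro!: derivative_eq_intros simp: field_simps\<close>)

lemma deriv_H_lam: "deriv (\<lambda>l. H t l m0) l0 = dH_dlam"
  unfolding H_eq dH_dlam_def
  by (rule DERIV_imp_deriv)
     (use M in \<open>auto intro!: derivative_eq_intros has_partials_fixed_t[OF \<eta>[OF \<sigma>_nz]] simp: field_simps\<close>)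

lemma hamilton_iff:
  "hamilton_equations {t} H lam mu \<longleftrightarrow> l' = dH_dmu \<and> m' + dH_dlam = 0"
  unfolding hamilton_equations_def by (auto simp: deriv_H_mu deriv_H_lam add_eq_0_iff)

lemma pole_z:
  assumes "z \<noteq> l0"
  shows "((\<lambda>z. 1 / (z - l0)) has_field_derivative - (1 / (z - l0))\<^sup>2) (at z)"
  using assms by (auto intro!: derivative_eq_intros simp: power2_eq_square divide_simps)

lemma pole_t:
  assumes "z \<noteq> l0"
  shows "((\<lambda>u. 1 / (z - lam u)) has_field_derivative l' * (1 / (z - l0))\<^sup>2) (at t)"
  using assms by (auto intro!: derivative_eq_intros lam' simp: power2_eq_square divide_simps)

lemma inverse_\<sigma>_z:
  assumes "poly S z \<noteq> 0"
  shows "((\<lambda>z. 1 / poly S z) has_field_derivative - poly (pderiv S) z * (1 / poly S z)\<^sup>2) (at z)"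
  using assms by (auto intro!: derivative_eq_intros simp: power2_eq_square divide_simps)

lemma inverse_\<sigma>_t:
  assumes "\<sigma> t z \<noteq> 0"
  shows "((\<lambda>u. 1 / \<sigma> u z) has_field_derivative - poly St z * (1 / poly S z)\<^sup>2) (at t)"
  using assms
  by (auto intro!: derivative_eq_intros has_partials_fixed_z[OF \<sigma>] simp: power2_eq_square \<sigma>_eq)

lemma deriv_a:
  assumes z: "z \<noteq> l0" and w: "w = 1 / (z - l0)"
  shows "deriv (a t l0 m0) z = (1 / M) * (poly (pderiv G) z * w - poly G z * w\<^sup>2)"
proof -
  have e: "a t l0 m0 = (\<lambda>z. (1 / M) * (poly G z * (1 / (z - l0))))" using a by auto
  show ?thesis
    unfolding e
    by (rule DERIV_imp_deriv, (rule DERIV_cmult DERIV_mult pole_z[OF z] poly_DERIV derivative_eq_intros)+)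
       (simp add: w algebra_simps)
qed

lemma deriv2_a:
  assumes z: "z \<noteq> l0" and w: "w = 1 / (z - l0)"
  shows "(deriv ^^ 2) (a t l0 m0) z = (1 / M) * (poly (pderiv (pderiv G)) z * w
           - 2 * poly (pderiv G) z * w\<^sup>2 + 2 * poly G z * w ^ 3)"
proof -
  have "eventually (\<lambda>x. x \<noteq> l0) (nhds z)" using z by (rule t1_space_nhds)
  then have "eventually (\<lambda>x. deriv (a t l0 m0) x = (1 / M) * (poly (pderiv G) x * (1 / (x - l0))
      - poly G x * (1 / (x - l0))\<^sup>2)) (nhds z)"
    by eventually_elim (rule deriv_a[OF _ refl])
  then have "deriv (deriv (a t l0 m0)) z
      = deriv (\<lambda>x. (1 / M) * (poly (pderiv G) x * (1 / (x - l0)) - poly G x * (1 / (x - l0))\<^sup>2)) z"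
    by (rule deriv_cong_ev) simp
  also have "\<dots> = (1 / M) * (poly (pderiv (pderiv G)) z * w
           - 2 * poly (pderiv G) z * w\<^sup>2 + 2 * poly G z * w ^ 3)"
    unfolding power2_eq_square[of "1 / _"]
    by (rule DERIV_imp_deriv, (rule DERIV_cmult DERIV_diff DERIV_mult pole_z[OF z] poly_DERIV
        derivative_eq_intros)+)
       (simp add: w[symmetric] algebra_simps power2_eq_square power3_eq_cube del: times_divide_eq_left
           times_divide_eq_right)
  finally show ?thesis by (simp add: numeral_2_eq_2)
qed

lemma deriv_b:
  assumes z: "z \<noteq> l0" and w: "w = 1 / (z - l0)"
  shows "deriv (b t l0 m0) z = poly S l0 * m0 * (1 / M) * w\<^sup>2"
proof -
  have e: "b t l0 m0 = (\<lambda>z. - (poly S l0 * m0 * (1 / M)) * (1 / (z - l0)))" using b \<sigma>_eq by auto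
  show ?thesis
    unfolding e
    by (rule DERIV_imp_deriv[OF DERIV_cong[OF DERIV_cmult[OF pole_z[OF z]]]]) (simp add: w)
qed

lemma deriv2_b:
  assumes z: "z \<noteq> l0" and w: "w = 1 / (z - l0)"
  shows "(deriv ^^ 2) (b t l0 m0) z = - 2 * poly S l0 * m0 * (1 / M) * w ^ 3"
proof -
  have "eventually (\<lambda>x. x \<noteq> l0) (nhds z)" using z by (rule t1_space_nhds)
  then have "eventually (\<lambda>x. deriv (b t l0 m0) x = poly S l0 * m0 * (1 / M) * (1 / (x - l0))\<^sup>2) (nhds z)"
    by eventually_elim (rule deriv_b[OF _ refl])
  then have "deriv (deriv (b t l0 m0)) z = deriv (\<lambda>x. poly S l0 * m0 * (1 / M) * (1 / (x - l0))\<^sup>2) z"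
    by (rule deriv_cong_ev) simp
  also have "\<dots> = - 2 * poly S l0 * m0 * (1 / M) * w ^ 3"
    unfolding power2_eq_square[of "1 / _"]
    by (rule DERIV_imp_deriv[OF DERIV_cong[OF DERIV_cmult[OF DERIV_mult[OF pole_z[OF z] pole_z[OF z]]]]])
       (simp add: w[symmetric] algebra_simps power2_eq_square power3_eq_cube del: times_divide_eq_left
           times_divide_eq_right)
  finally show ?thesis by (simp add: numeral_2_eq_2)
qed

lemma deriv_p_z:
  assumes s: "\<sigma> t z \<noteq> 0" and z: "z \<noteq> l0" and w: "w = 1 / (z - l0)" and i: "i = 1 / poly S z"
  shows "deriv (deformed_p (\<sigma> t) (\<tau> t) l0) z
      = (poly (pderiv P) z * i - poly P z * poly (pderiv S) z * i\<^sup>2) + w\<^sup>2"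
proof -
  have s': "poly S z \<noteq> 0" using s by (simp_all add: \<sigma>_eq)
  have e: "deformed_p (\<sigma> t) (\<tau> t) l0 = (\<lambda>z. poly P z * (1 / poly S z) - 1 / (z - l0))"
    unfolding deformed_p_def by (simp add: \<sigma>_eq \<tau>_eq)
  show ?thesis
    unfolding e
    by (rule DERIV_imp_deriv, (rule DERIV_mult DERIV_diff pole_z[OF z] inverse_\<sigma>_z[OF s'] poly_DERIV
        derivative_eq_intros)+)
       (simp add: w i algebra_simps)
qed

lemma deriv_p_t:
  assumes s: "\<sigma> t z \<noteq> 0" and z: "z \<noteq> l0" and w: "w = 1 / (z - l0)" and i: "i = 1 / poly S z"
  shows "deriv (\<lambda>u. deformed_p (\<sigma> u) (\<tau> u) (lam u) z) t = poly Pt z * i - poly P z * poly St z * i\<^sup>2 - l' * w\<^sup>2"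
proof -
  have e: "(\<lambda>u. deformed_p (\<sigma> u) (\<tau> u) (lam u) z) = (\<lambda>u. \<tau> u z * (1 / \<sigma> u z) - 1 / (z - lam u))"
    unfolding deformed_p_def by simp
  show ?thesis
    unfolding e
    by (rule DERIV_imp_deriv, (rule DERIV_mult DERIV_diff pole_t[OF z] inverse_\<sigma>_t[OF s]
        has_partials_fixed_z[OF \<tau>] derivative_eq_intros)+)
       (simp add: w i \<sigma>_eq \<tau>_eq algebra_simps)
qed

text \<open>
  The bracket in \<open>q\<close>, so that \<open>q = Q / \<sigma>\<close>.
\<close>

definition "Q z = \<eta> t z - \<eta> t l0 - m0 * (poly P l0 - poly (pderiv S) l0) - m0\<^sup>2 * poly S l0
    + m0 * poly S l0 * (1 / (z - l0))"

lemma deriv_\<sigma>: "deriv (\<sigma> t) l0 = poly (pderiv S) l0"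
  using has_partials_fixed_t[OF \<sigma>] by (rule DERIV_imp_deriv)

lemma q_eq: "deformed_q (\<sigma> t) (\<tau> t) (\<eta> t) l0 m0 z = Q z * (1 / poly S z)"
  unfolding deformed_q_def Q_def deriv_\<sigma> by (simp add: \<sigma>_eq \<tau>_eq)

lemma deriv_q_z:
  assumes s: "\<sigma> t z \<noteq> 0" and z: "z \<noteq> l0" and w: "w = 1 / (z - l0)" and i: "i = 1 / poly S z"
  shows "deriv (deformed_q (\<sigma> t) (\<tau> t) (\<eta> t) l0 m0) z
     = (\<eta>z z - m0 * poly S l0 * w\<^sup>2) * i - Q z * poly (pderiv S) z * i\<^sup>2"
proof -
  have s': "poly S z \<noteq> 0" using s by (simp_all add: \<sigma>_eq)
  have Q': "(Q has_field_derivative \<eta>z z - m0 * poly S l0 * w\<^sup>2) (at z)"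
    unfolding Q_def[abs_def]
    by (rule derivative_eq_intros has_partials_fixed_t[OF \<eta>[OF s]] pole_z[OF z] refl)+
       (simp add: w)
  have e: "deformed_q (\<sigma> t) (\<tau> t) (\<eta> t) l0 m0 = (\<lambda>z. Q z * (1 / poly S z))"
    using q_eq by auto
  show ?thesis
    unfolding e
    by (rule DERIV_imp_deriv, (rule DERIV_mult Q' inverse_\<sigma>_z[OF s'] derivative_eq_intros)+)
       (simp add: i algebra_simps)
qed

lemma deriv_q_t:
  assumes s: "\<sigma> t z \<noteq> 0" and z: "z \<noteq> l0" and w: "w = 1 / (z - l0)" and i: "i = 1 / poly S z"
    and dQ: "dQ = \<eta>t z - (\<eta>t l0 + \<eta>z l0 * l') - (m' * (poly P l0 - poly (pderiv S) l0)
       + m0 * ((poly Pt l0 + poly (pderiv P) l0 * l') -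
           (poly (pderiv St) l0 + poly (pderiv (pderiv S)) l0 * l')))
       - (2 * m0 * m' * poly S l0 + m0\<^sup>2 * (poly St l0 + poly (pderiv S) l0 * l'))
      + ((m' * poly S l0 + m0 * (poly St l0 + poly (pderiv S) l0 * l')) * w + m0 * poly S l0 * l' * w\<^sup>2)"
  shows "deriv (\<lambda>u. deformed_q (\<sigma> u) (\<tau> u) (\<eta> u) (lam u) (mu u) z) t = dQ * i - Q z * poly St z * i\<^sup>2"
proof -
  note c = has_partials_curve[OF \<sigma> lam'] has_partials_curve[OF \<sigma>' lam']
     has_partials_curve[OF \<tau> lam'] has_partials_curve[OF \<eta>[OF \<sigma>_nz] lam']
     has_partials_fixed_z[OF \<eta>, OF s]
  define Qu where "Qu = (\<lambda>u. \<eta> u z - \<eta> u (lam u) - mu u * (\<tau> u (lam u) - deriv (\<sigma> u) (lam u))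
     - (mu u)\<^sup>2 * \<sigma> u (lam u) + mu u * \<sigma> u (lam u) * (1 / (z - lam u)))"
  have dQ': "(Qu has_field_derivative dQ) (at t)"
    unfolding dQ Qu_def
    by (rule derivative_eq_intros c lam' mu' pole_t[OF z] refl)+
       (simp add: w \<sigma>_eq \<tau>_eq deriv_\<sigma> algebra_simps)
  have Qt: "Qu t = Q z"
    unfolding Q_def Qu_def by (simp add: \<sigma>_eq \<tau>_eq deriv_\<sigma>)
  have e: "(\<lambda>u. deformed_q (\<sigma> u) (\<tau> u) (\<eta> u) (lam u) (mu u) z) = (\<lambda>u. Qu u * (1 / \<sigma> u z))"
    unfolding deformed_q_def Qu_def by simp
  show ?thesis
    unfolding e
    by (rule DERIV_imp_deriv, (rule DERIV_mult dQ' inverse_\<sigma>_t[OF s] derivative_eq_intros)+)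
       (simp add: i Qt \<sigma>_eq algebra_simps)
qed

text \<open>
  The first condition at a single \<open>z\<close> already gives the first Hamilton equation. For the second
  one, \<open>z\<close> has to avoid the zero of \<open>\<sigma>(\<lambda>) w - \<kappa>\<close>; near \<open>\<lambda>\<close> this is automatic because the pole
  dominates. The assumptions \<open>eta\<close>, \<open>tau\<close>, \<open>sigma\<close> are the coefficients of \<open>\<mu>\<^sup>0\<close>, \<open>\<mu>\<^sup>1\<close>, \<open>\<mu>\<^sup>2\<close>.
\<close>

lemma hamilton_iff_compatibility_at:
  assumes pole_cancels: "\<And>z w i. \<lbrakk>poly S z \<noteq> 0; w * (z - l0) = 1; i * poly S z = 1\<rbrakk> \<Longrightarrow>
     M * (poly Pt z * i - poly P z * poly St z * i\<^sup>2) =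
     (poly (pderiv P) z * poly G z * i + poly P z * poly (pderiv G) z * i
        - poly P z * poly G z * poly (pderiv S) z * i\<^sup>2 - poly (pderiv (pderiv G)) z) * w
     - (poly P z * poly G z * i - poly (pderiv G) z - poly P l0 + poly h l0) * w\<^sup>2"
  and eta: "\<And>z w i. \<lbrakk>poly S z \<noteq> 0; w * (z - l0) = 1; i * poly S z = 1\<rbrakk> \<Longrightarrow>
     M * (\<eta>t z - \<eta>t l0) + (poly h l0 - poly (pderiv S) l0) * \<eta>z l0 - poly S l0 * \<eta>z l0 * w
     - M * (\<eta> t z - \<eta> t l0) * poly St z * i - 2 * (\<eta> t z - \<eta> t l0) * poly (pderiv G) z * w
     + 2 * (\<eta> t z - \<eta> t l0) * poly G z * w\<^sup>2 - poly G z * w * \<eta>z z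
     + (\<eta> t z - \<eta> t l0) * w * poly G z * i * poly (pderiv S) z = 0"
  and tau: "\<And>z w i Q1. \<lbrakk>poly S z \<noteq> 0; w * (z - l0) = 1; i * poly S z = 1;
       Q1 = poly S l0 * w - (poly P l0 - poly (pderiv S) l0)\<rbrakk> \<Longrightarrow>
     - M * (poly Pt l0 - poly (pderiv St) l0)
     - (poly P l0 - poly h l0) * (poly (pderiv P) l0 - poly (pderiv (pderiv S)) l0)
     + (poly (pderiv P) l0 - poly (pderiv h) l0) * (poly P l0 - poly (pderiv S) l0)
     + w * (poly St l0 * M + poly (pderiv S) l0 * (poly P l0 - poly h l0)
         - (poly (pderiv P) l0 - poly (pderiv h) l0) * poly S l0)
     + poly S l0 * (poly P l0 - poly h l0) * w\<^sup>2 - M * Q1 * poly St z * i + poly S l0 * poly P z * w\<^sup>2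
     - 3 * poly S z * poly S l0 * w ^ 3 - 2 * Q1 * poly (pderiv G) z * w + 2 * Q1 * poly G z * w\<^sup>2
     + poly G z * poly S l0 * w ^ 3 + Q1 * w * poly G z * i * poly (pderiv S) z = 0"
  and sigma: "\<And>z w i. \<lbrakk>poly S z \<noteq> 0; w * (z - l0) = 1; i * poly S z = 1\<rbrakk> \<Longrightarrow>
     - M * poly St l0 + (poly h l0 - poly (pderiv S) l0) * poly (pderiv S) l0
     + 2 * poly S l0 * (poly (pderiv (pderiv S)) l0 - poly (pderiv h) l0)
     + w * poly S l0 * poly (pderiv S) l0 + 2 * (poly S l0)\<^sup>2 * w\<^sup>2 + M * poly S l0 * poly St z * i
     + 2 * poly S l0 * poly (pderiv G) z * w - 2 * poly S l0 * poly G z * w\<^sup>2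
     - poly S l0 * w * poly G z * i * poly (pderiv S) z = 0"
  shows "hamilton_iff_compatible_at \<sigma> \<tau> \<eta> a b H lam mu t"
proof -
  let ?C1 = "\<lambda>z. deriv (\<lambda>u. deformed_p (\<sigma> u) (\<tau> u) (lam u) z) t
    - a t l0 m0 z * deriv (deformed_p (\<sigma> t) (\<tau> t) l0) z + 2 * deriv (b t l0 m0) z
    - deformed_p (\<sigma> t) (\<tau> t) l0 z * deriv (a t l0 m0) z + (deriv ^^ 2) (a t l0 m0) z"
  let ?C2 = "\<lambda>z. deriv (\<lambda>u. deformed_q (\<sigma> u) (\<tau> u) (\<eta> u) (lam u) (mu u) z) t
    + deformed_p (\<sigma> t) (\<tau> t) l0 z * deriv (b t l0 m0) z
    - 2 * deformed_q (\<sigma> t) (\<tau> t) (\<eta> t) l0 m0 z * deriv (a t l0 m0) z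
    - a t l0 m0 z * deriv (deformed_q (\<sigma> t) (\<tau> t) (\<eta> t) l0 m0) z + (deriv ^^ 2) (b t l0 m0) z"
  define \<kappa> where "\<kappa> = poly P l0 - poly (pderiv S) l0 + 2 * m0 * poly S l0"
  define j where "j = 1 / M"
  have M1: "M * j = 1" using M by (simp add: j_def)
  have p: "deformed_p (\<sigma> t) (\<tau> t) l0 z = poly P z * i - w" if "w = 1 / (z - l0)" "i = 1 / poly S z" for z w i
    unfolding deformed_p_def by (simp add: \<sigma>_eq \<tau>_eq that)
  have a': "a t l0 m0 z = poly G z * j * w" if "w = 1 / (z - l0)" for z w
    by (simp add: a j_def that)
  have C1: "?C1 z = (dH_dmu - l') * (1 / (z - l0))\<^sup>2" if s: "\<sigma> t z \<noteq> 0" and z: "z \<noteq> l0" for z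
  proof -
    define w i where w: "w = 1 / (z - l0)" and i: "i = 1 / poly S z"
    have z': "poly S z \<noteq> 0" "w * (z - l0) = 1" "i * poly S z = 1"
      using s z by (simp_all add: \<sigma>_eq w i)
    have H': "dH_dmu = j * (2 * poly S l0 * m0 + poly P l0 - poly h l0)"
      by (simp add: dH_dmu_def j_def)
    show ?thesis
      unfolding w[symmetric] p[OF w i] a'[OF w] deriv_a[OF z w] deriv2_a[OF z w] deriv_b[OF z w]
          deriv_p_z[OF s z w i]
        deriv_p_t[OF s z w i] j_def[symmetric] H' first_condition_reduces[OF M1 pole_cancels[OF z'], symmetric]
      by (simp add: algebra_simps)
  qed
  have C2: "poly S z * ?C2 z = (poly S l0 * (1 / (z - l0)) - \<kappa>) * (m' + dH_dlam)"
    if s: "\<sigma> t z \<noteq> 0" and z: "z \<noteq> l0" and l': "l' = dH_dmu" for z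
  proof -
    define w i where w: "w = 1 / (z - l0)" and i: "i = 1 / poly S z"
    have z': "poly S z \<noteq> 0" "w * (z - l0) = 1" "i * poly S z = 1"
      using s z by (simp_all add: \<sigma>_eq w i)
    have s1: "poly S z * i = 1" using z' by (simp add: mult.commute)
    have Ml: "M * l' = 2 * poly S l0 * m0 + poly P l0 - poly h l0"
      unfolding l' dH_dmu_def using M by simp
    have H': "dH_dlam = j * (poly (pderiv S) l0 * m0\<^sup>2 + (poly (pderiv P) l0 - poly (pderiv h) l0) * m0
        + \<eta>z l0)"
      by (simp add: dH_dlam_def j_def)
    have Qz: "Q z = \<eta> t z - \<eta> t l0 - m0 * (poly P l0 - poly (pderiv S) l0) - m0\<^sup>2 * poly S l0
        + m0 * poly S l0 * w"
      by (simp only: Q_def w)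
    show ?thesis
      unfolding w[symmetric] p[OF w i] a'[OF w] q_eq deriv_a[OF z w] deriv2_b[OF z w] deriv_b[OF z w]
          deriv_q_z[OF s z w i]
        deriv_q_t[OF s z w i refl] j_def[symmetric] H' i[symmetric] \<kappa>_def
        second_condition_reduces[OF M1 s1 Ml eta[OF z'] refl tau[OF z' refl] sigma[OF z'] Qz refl, symmetric]
      by (simp add: algebra_simps)
  qed
  \<comment> \<open>The second conjunct says that \<open>z - \<lambda>\<close> times the factor \<open>\<sigma>(\<lambda>) w - \<kappa>\<close> is nonzero.\<close>
  have "\<forall>\<^sub>F z in at l0. poly S z \<noteq> 0 \<and> poly S l0 - \<kappa> * (z - l0) \<noteq> 0 \<and> z \<noteq> l0"
  proof (intro eventually_conj)
    have S0: "poly S l0 \<noteq> 0" using \<sigma>_nz by (simp add: \<sigma>_eq)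
    have lim: "(poly S \<longlongrightarrow> poly S l0) (at l0)"
      "((\<lambda>z. poly S l0 - \<kappa> * (z - l0)) \<longlongrightarrow> poly S l0 - \<kappa> * (l0 - l0)) (at l0)"
      by (intro tendsto_intros)+
    show "\<forall>\<^sub>F z in at l0. poly S z \<noteq> 0" "\<forall>\<^sub>F z in at l0. poly S l0 - \<kappa> * (z - l0) \<noteq> 0"
      using lim[THEN tendsto_imp_eventually_ne, of 0] S0 by auto
    show "\<forall>\<^sub>F z in at l0. z \<noteq> l0" by (simp add: eventually_at_filter)
  qed
  then obtain z0 where z0: "poly S z0 \<noteq> 0" "poly S l0 - \<kappa> * (z0 - l0) \<noteq> 0" "z0 \<noteq> l0"
    using eventually_happens' [OF at_neq_bot] by blast
  have z0': "poly S l0 * (1 / (z0 - l0)) - \<kappa> \<noteq> 0" "\<sigma> t z0 \<noteq> 0"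
    using z0 by (auto simp: \<sigma>_eq field_simps)
  have "l' = dH_dmu \<and> m' + dH_dlam = 0 \<longleftrightarrow> (\<forall>z. \<sigma> t z \<noteq> 0 \<and> z \<noteq> l0 \<longrightarrow> ?C1 z = 0 \<and> ?C2 z = 0)" (is "?L \<longleftrightarrow> ?R")
  proof
    assume L: ?L
    show ?R
    proof (intro allI impI)
      fix z assume z: "\<sigma> t z \<noteq> 0 \<and> z \<noteq> l0"
      have "poly S z * ?C2 z = 0"
        using C2[of z] z L by simp
      moreover have "poly S z \<noteq> 0" using z by (simp add: \<sigma>_eq)
      ultimately have "?C2 z = 0" by (simp only: mult_eq_0_iff simp_thms)
      then show "?C1 z = 0 \<and> ?C2 z = 0" using C1[of z] z L by simp
    qed
  next
    assume R: ?R
    then have "?C1 z0 = 0" "?C2 z0 = 0" using z0 z0' by blast+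
    then have "(dH_dmu - l') * (1 / (z0 - l0))\<^sup>2 = 0" using C1[of z0] z0 z0' by simp
    then have l': "l' = dH_dmu" using z0 by simp
    then have "(poly S l0 * (1 / (z0 - l0)) - \<kappa>) * (m' + dH_dlam) = 0"
      using C2[of z0] z0 z0' \<open>?C2 z0 = 0\<close> by simp
    then show ?L using z0' l' by (simp only: mult_eq_0_iff) simp
  qed
  then show ?thesis
    unfolding hamilton_iff compatibility_conditions_def by auto
qed

end

section \<open>Taylor expansions of polynomials of low degree\<close>

lemma poly_taylor2:
  fixes p :: "complex poly"
  assumes "degree p \<le> 2"
  shows "poly p z = poly p l + poly (pderiv p) l * (z - l) + coeff p 2 * (z - l)\<^sup>2"
    and "poly (pderiv p) z = poly (pderiv p) l + 2 * coeff p 2 * (z - l)"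
    and "poly (pderiv (pderiv p)) z = 2 * coeff p 2"
proof -
  obtain c0 c1 c2 where p: "p = [:c0, c1, c2:]"
  proof
    show "p = [:coeff p 0, coeff p 1, coeff p 2:]"
      using assms by (intro poly_eqI) (auto simp: coeff_pCons numeral_2_eq_2 coeff_eq_0 split: nat.split)
  qed
  show "poly p z = poly p l + poly (pderiv p) l * (z - l) + coeff p 2 * (z - l)\<^sup>2"
    and "poly (pderiv p) z = poly (pderiv p) l + 2 * coeff p 2 * (z - l)"
    and "poly (pderiv (pderiv p)) z = 2 * coeff p 2"
    unfolding p by (simp_all add: pderiv_pCons numeral_2_eq_2 algebra_simps power2_eq_square)
qed

text \<open>
  Only the coefficient of the cube enters later, through the data at infinity; the quadratic one
  cancels and is left unnamed.
\<close>

lemma poly_taylor3: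
  fixes p :: "complex poly"
  assumes "degree p \<le> 3"
  obtains c where "\<And>z. poly p z = poly p l + poly (pderiv p) l * (z - l) + c * (z - l)\<^sup>2
      + coeff p 3 * (z - l) ^ 3"
    and "\<And>z. poly (pderiv p) z = poly (pderiv p) l + 2 * c * (z - l) + 3 * coeff p 3 * (z - l)\<^sup>2"
proof
  obtain c0 c1 c2 c3 where p: "p = [:c0, c1, c2, c3:]"
  proof
    show "p = [:coeff p 0, coeff p 1, coeff p 2, coeff p 3:]"
      using assms by (intro poly_eqI)
          (auto simp: coeff_pCons numeral_2_eq_2 numeral_3_eq_3 coeff_eq_0 split: nat.split)
  qed
  let ?c = "coeff p 2 + 3 * coeff p 3 * l"
  show "poly p z = poly p l + poly (pderiv p) l * (z - l) + ?c * (z - l)\<^sup>2 + coeff p 3 * (z - l) ^ 3"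
    "poly (pderiv p) z = poly (pderiv p) l + 2 * ?c * (z - l) + 3 * coeff p 3 * (z - l)\<^sup>2" for z
    unfolding p by (simp_all add: pderiv_pCons numeral_2_eq_2 numeral_3_eq_3 algebra_simps
        power2_eq_square power3_eq_cube)
qed

section \<open>The identities for a deformation at infinity\<close>

text \<open>
  Here and below \<open>d = z - \<lambda>\<close>, and \<open>s\<close>, \<open>\<tau>\<close> are given by their Taylor expansions at \<open>\<lambda>\<close>. Since
  \<open>G = \<sigma>\<close>, the function \<open>p a - a'\<close> is \<open>(\<tau> - \<sigma>') w / M\<close>, and for a quadratic polynomial the
  derivative of a difference quotient is its leading coefficient. So \<open>\<tau>/\<sigma>\<close> has to move with
  speed \<open>t2 / M\<close>.
\<close>

lemma infinity_first_identity:
  fixes M :: complex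
  assumes d: "w * d = 1" and i: "i * s = 1"
   and s: "s = s0 + s1 * d + s2 * d^2" and t: "\<tau> = t0 + t1 * d + t2 * d^2"
   and tt: "M * tt = t2 * s" and tz: "tz = t1 + 2 * t2 * d" and sz: "sz = s1 + 2 * s2 * d" and s2':
       "szz = 2 * s2"
  shows "M * (tt * i - \<tau> * 0 * i^2) = (tz * s * i + \<tau> * sz * i - \<tau> * s * sz * i^2 - szz) * w
      - (\<tau> * s * i - sz - t0 + s1) * w^2" (is "_ = ?R")
proof -
  have "?R = (tz - szz) * w - (\<tau> - sz - t0 + s1) * w^2"
    using i by algebra
  also have "\<dots> = t2"
    using d unfolding t tz sz s2' by algebra
  also have "\<dots> = M * (tt * i - \<tau> * 0 * i^2)"
    using tt i by algebra
  finally show ?thesis by simp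
qed

lemma infinity_tau_identity:
  fixes M :: complex
  assumes d: "w * d = 1" and i: "i * s = 1"
   and s: "s = s0 + s1 * d + s2 * d^2" and t: "\<tau> = t0 + t1 * d + t2 * d^2"
   and tt: "M * t0t = t2 * s0" and Q1: "Q1 = s0 * w - (t0 - s1)"
   and sz: "sz = s1 + 2 * s2 * d" and s2': "szz = 2 * s2"
  shows "- M * (t0t - 0) - (t0 - s1) * (t1 - szz) + (t1 - szz) * (t0 - s1)
      + w * (0 * M + s1 * (t0 - s1) - (t1 - szz) * s0) + s0 * (t0 - s1) * w^2 - M * Q1 * 0 * i + s0 * \<tau> *
      w^2 - 3 * s * s0 * w^3 - 2 * Q1 * sz * w + 2 * Q1 * s * w^2 + s * s0 * w^3 + Q1 * w * s * i * sz = 0"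
  (is "?L = 0")
proof -
  have "?L = - t2 * s0 +  w * (s1 * (t0 - s1) - (t1 - szz) * s0) + s0 * (t0 - s1) * w^2 + s0 * \<tau> * w^2
      - 2 * s * s0 * w^3 - Q1 * sz * w + 2 * Q1 * s * w^2"
    using i tt by algebra
  also have "\<dots> = 0"
    using d unfolding Q1 s t sz s2' by algebra
  finally show ?thesis .
qed

lemma infinity_sigma_identity:
  fixes M :: complex
  assumes d: "w * d = 1" and i: "i * s = 1"
   and s: "s = s0 + s1 * d + s2 * d^2" and sz: "sz = s1 + 2 * s2 * d"
  shows "- M * 0 + (s1 - s1) * s1 + 2 * s0 * (szz - szz) + w * s0 * s1 + 2 * s0^2 * w^2 + M * s0 * 0 * i
      + 2 * s0 * sz * w - 2 * s0 * s * w^2 - s0 * w * s * i * sz = 0"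
  (is "?L = 0")
proof -
  have "?L = w * s0 * s1 + 2 * s0^2 * w^2 + s0 * sz * w - 2 * s0 * s * w^2"
    using i by algebra
  also have "\<dots> = 0"
    using d unfolding s sz by algebra
  finally show ?thesis .
qed

text \<open>
  The Taylor coefficients of \<open>N = \<sigma> \<eta>\<close> up to order two cancel, and the cubic one forces \<open>\<eta>\<close> to
  move with speed \<open>n3 z / M\<close>, up to a constant.
\<close>

lemma infinity_eta_identity:
  fixes M :: complex
  assumes d: "w * d = 1" and i: "i * s = 1"
   and s: "s = s0 + s1 * d + s2 * d^2" and sz: "sz = s1 + 2 * s2 * d"
   and e0: "s0 * e0 = n0" and e0z: "s0 * e0z + s1 * e0 = n1"
   and e: "s * e = n0 + n1 * d + n2 * d^2 + n3 * d^3"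
   and ez: "s * ez + sz * e = n1 + 2 * n2 * d + 3 * n3 * d^2"
   and et: "M * (et - e0t) = n3 * d"
  shows "M * (et - e0t) + (s1 - s1) * e0z - s0 * e0z * w - M * (e - e0) * 0 * i - 2 * (e - e0) * sz * w
      + 2 * (e - e0) * s * w^2 - s * w * ez + (e - e0) * w * s * i * sz = 0"
  (is "?L = 0")
proof -
  have "?L = n3 * d - (s0 * e0z) * w - (e - e0) * sz * w + 2 * (s * e - e0 * s) * w^2 - (s * ez) * w"
    unfolding et using i by algebra
  also have "\<dots> = n3 * d - (n1 - s1 * e0) * w  + e0 * sz * w
      + 2 * (n0 + n1 * d + n2 * d^2 + n3 * d^3 - e0 * s) * w^2 - (n1 + 2 * n2 * d + 3 * n3 * d^2) * w"
    using e ez e0z by algebra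
  also have "\<dots> = 0"
    using d unfolding sz s e0[symmetric] by algebra
  finally show ?thesis .
qed

section \<open>The identities for a deformation at a finite singular point\<close>

text \<open>
  Here \<open>g = \<lambda> - s\<close>, \<open>d = z - \<lambda>\<close>, \<open>y = z - s\<close>, so that \<open>\<sigma> = y \<rho>\<close> and \<open>G = g \<rho>\<close>; \<open>u\<close>, \<open>v\<close>, \<open>r\<close> are
  the reciprocals of \<open>y\<close>, \<open>g\<close>, \<open>\<rho>\<close>, and \<open>rs\<close>, \<open>ts\<close> are \<open>\<rho>(s)\<close>, \<open>\<tau>(s)\<close>. The product \<open>G \<tau>/\<sigma>\<close> is
  \<open>g \<tau>/y\<close>, whose polar part at \<open>s\<close> is \<open>g \<tau>(s)/y\<close>. What survives is the derivative of that pole,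
  so \<open>\<tau>/\<sigma>\<close> has to move with speed \<open>\<tau>(s) u\<^sup>2 / M\<close>.
\<close>

lemma finite_first_identity:
  fixes M :: complex
  assumes d: "w * d = 1" and u: "u * y = 1" and y: "y = g + d" and r: "r * \<rho> = 1" and i: "i = u * r"
   and t: "\<tau> = t0 + t1 * d + t2 * d^2"
   and ts: "ts = t0 - t1 * g + t2 * g^2" and tz: "tz = t1 + 2 * t2 * d"
   and tt: "M * tt = (\<rho> * ts - \<tau> * rs) * u"
   and st: "M * st = - rs * \<rho>"
   and d\<rho>: "d\<rho> = r1 + 2 * r2 * d"
   and G: "G = g * \<rho>" and G1: "G1 = g * d\<rho>" and G2: "G2 = g * (2 * r2)"
   and sz: "sz = \<rho> + y * d\<rho>" and h: "h = g * r1"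
  shows "M * (tt * i - \<tau> * st * i^2) = (tz * G * i + \<tau> * G1 * i - \<tau> * G * sz * i^2 - G2) * w
      - (\<tau> * G * i - G1 - t0 + h) * w^2" (is "?L = ?R")
proof -
  have "?L = u^2 * ts"
    using tt st r unfolding i by algebra
  moreover have "G * i = g * u" "G1 * i - G * sz * i^2 = - g * u^2"
    using r u unfolding i G G1 sz by algebra+
  then have "?R = (tz * g * u - \<tau> * g * u^2 - G2) * w - (\<tau> * g * u - G1 - t0 + h) * w^2"
    by algebra
  moreover have "u^2 * ts = (tz * g * u - \<tau> * g * u^2 - G2) * w - (\<tau> * g * u - G1 - t0 + h) * w^2"
    using d u unfolding ts t tz G1 G2 h d\<rho> y by algebra
  ultimately show ?thesis by simp
qed

lemma finite_sigma_identity: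
  fixes M :: complex
  assumes d: "w * d = 1" and u: "u * y = 1" and y: "y = g + d" and r: "r * \<rho> = 1" and i: "i = u * r"
   and \<rho>: "\<rho> = r0 + r1 * d + r2 * d^2"
   and rs: "rs = r0 - r1 * g + r2 * g^2"
   and st: "M * st = - rs * \<rho>"  and s0t: "M * s0t = - rs * r0"
   and d\<rho>: "d\<rho> = r1 + 2 * r2 * d"
   and s0: "s0 = g * r0" and s0z: "s0z = r0 + g * r1"
   and s0zz: "s0zz = 2 * r1 + 2 * g * r2" and h: "h = g * r1" and h': "h' = r1 + 2 * g * r2"
   and G: "G = g * \<rho>" and G1: "G1 = g * d\<rho>" and sz: "sz = \<rho> + y * d\<rho>"
  shows "- M * s0t + (h - s0z) * s0z + 2 * s0 * (s0zz - h') + w * s0 * s0z + 2 * s0^2 * w^2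
      + M * s0 * st * i + 2 * s0 * G1 * w - 2 * s0 * G * w^2 - s0 * w * G * i * sz = 0" (is "?L = 0")
proof -
  have "M * st * i = - rs * u" "G * i * sz = g * (u * \<rho> + d\<rho>)"
    using r u st unfolding i G sz by algebra+
  then have "?L = rs * r0 + (h - s0z) * s0z + 2 * s0 * (s0zz - h') + w * s0 * s0z + 2 * s0^2 * w^2
      - s0 * (rs * u) + 2 * s0 * G1 * w - 2 * s0 * G * w^2 - s0 * w * (g * (u * \<rho> + d\<rho>))"
    using s0t by algebra
  also have "\<dots> = 0"
    using d u unfolding rs s0 s0z s0zz h h' G G1 \<rho> d\<rho> y by algebra
  finally show ?thesis .
qed

lemma finite_tau_identity:
  fixes M :: complex
  assumes d: "w * d = 1" and u: "u * y = 1" and y: "y = g + d" and r: "r * \<rho> = 1" and i: "i = u * r"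
   and v: "v * g = 1"
   and \<rho>: "\<rho> = r0 + r1 * d + r2 * d^2"
   and rs: "rs = r0 - r1 * g + r2 * g^2"
   and t: "\<tau> = t0 + t1 * d + t2 * d^2"
   and ts: "ts = t0 - t1 * g + t2 * g^2"
   and t0t: "M * t0t = (r0 * ts - t0 * rs) * v"
   and st: "M * st = - rs * \<rho>"  and s0t: "M * s0t = - rs * r0" and s0zt: "M * s0zt = - rs * r1"
   and d\<rho>: "d\<rho> = r1 + 2 * r2 * d"
   and s: "s = y * \<rho>"
   and s0: "s0 = g * r0" and s0z: "s0z = r0 + g * r1"
   and s0zz: "s0zz = 2 * r1 + 2 * g * r2" and h: "h = g * r1" and h': "h' = r1 + 2 * g * r2"
   and G: "G = g * \<rho>" and G1: "G1 = g * d\<rho>" and sz: "sz = \<rho> + y * d\<rho>"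
   and Q1: "Q1 = s0 * w - (t0 - s0z)"
  shows "- M * (t0t - s0zt) - (t0 - h) * (t1 - s0zz) + (t1 - h') * (t0 - s0z)
      + w * (s0t * M + s0z * (t0 - h) - (t1 - h') * s0) + s0 * (t0 - h) * w^2 - M * Q1 * st * i + s0 * \<tau> *
      w^2 - 3 * s * s0 * w^3 - 2 * Q1 * G1 * w + 2 * Q1 * G * w^2 + G * s0 * w^3 + Q1 * w * G * i * sz =
      0" (is "?L = 0")
proof -
  have "M * st * i = - rs * u" "G * i * sz = g * (u * \<rho> + d\<rho>)"
    using r u st unfolding i G sz by algebra+
  moreover have "(r0 * ts - t0 * rs) * v = r0 * (- t1 + t2 * g) - t0 * (- r1 + r2 * g)"
    using v unfolding ts rs by algebra
  ultimately have "?L = - (r0 * (- t1 + t2 * g) - t0 * (- r1 + r2 * g)) - rs * r1 - (t0 - h) * (t1 - s0zz)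
      + (t1 - h') * (t0 - s0z) + w * (- rs * r0 + s0z * (t0 - h) - (t1 - h') * s0) + s0 * (t0 - h) * w^2 +
      Q1 * (rs * u) + s0 * \<tau> * w^2 - 3 * s * s0 * w^3 - 2 * Q1 * G1 * w + 2 * Q1 * G * w^2 + G * s0 * w^3
      + Q1 * w * (g * (u * \<rho> + d\<rho>))"
    using s0t s0zt t0t by algebra
  also have "\<dots> = 0"
    using d u unfolding Q1 rs s s0 s0z s0zz h h' G G1 \<rho> d\<rho> y t by algebra
  finally show ?thesis .
qed

text \<open>
  The identity is linear in \<open>\<eta>\<close> and its time derivative, so the part of \<open>\<eta>\<close> that is independent
  of \<open>t\<close> can be treated separately from the pole \<open>1 / (z - s)\<close>. With \<open>\<rho> e\<close> a cubic polynomial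
  \<open>N\<close>, the left-hand side reduces to a multiple of
  \<open>(N(s) - \<rho>(s) e(\<lambda>)) d / g + \<rho>(s) (e(z) - e(\<lambda>))\<close>. This vanishes when \<open>\<rho>(s) e\<close> is an affine
  function with value \<open>N(s)\<close> at \<open>s\<close>, which the assumptions \<open>L\<close> express.
\<close>

lemma finite_eta_identity_regular:
  fixes M :: complex
  assumes d: "w * d = 1" and u: "u * y = 1" and y: "y = g + d" and r: "r * \<rho> = 1" and i: "i = u * r"
   and g: "g \<noteq> 0"
   and \<rho>: "\<rho> = r0 + r1 * d + r2 * d^2"
   and rs: "rs = r0 - r1 * g + r2 * g^2"
   and st: "M * st = - rs * \<rho>"
   and d\<rho>: "d\<rho> = r1 + 2 * r2 * d"
   and s0: "s0 = g * r0" and s0z: "s0z = r0 + g * r1" and h: "h = g * r1"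
   and G: "G = g * \<rho>" and G1: "G1 = g * d\<rho>" and sz: "sz = \<rho> + y * d\<rho>"
   and e0: "r0 * e0 = p0" and e0z: "r0 * e0z + r1 * e0 = p1"
   and e: "\<rho> * e = p0 + p1 * d + p2 * d^2 + p3 * d^3"
   and ez: "\<rho> * ez + d\<rho> * e = p1 + 2 * p2 * d + 3 * p3 * d^2"
   and ps: "ps = p0 - p1 * g + p2 * g^2 - p3 * g^3"
   and L: "rs * (e - e0) = L1 * d" "ps - rs * e0 = - L1 * g"
  shows "(h - s0z) * e0z - s0 * e0z * w - M * (e - e0) * st * i - 2 * (e - e0) * G1 * w
      + 2 * (e - e0) * G * w^2 - G * w * ez + (e - e0) * w * G * i * sz = 0" (is "?L = 0")
proof -
  have "M * st * i = - rs * u" "G * i * sz = g * (u * \<rho> + d\<rho>)"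
    using r u st unfolding i G sz by algebra+
  then have "?L = - r0 * e0z - g * (r0 * e0z) * w + (rs * (e - e0)) * u - 2 * (e - e0) * g * d\<rho> * w
       + 2 * g * (\<rho> * (e - e0)) * w^2 - g * w * (\<rho> * ez) + w * g * u * (\<rho> * (e - e0)) + (e - e0) * w * g * d\<rho>"
    unfolding h s0z s0 G G1 by algebra
  also have "\<dots> = - (p1 - r1 * e0) - g * (p1 - r1 * e0) * w + L1 * d * u
       + 2 * g * (p0 + p1 * d + p2 * d^2 + p3 * d^3 - \<rho> * e0) * w^2
       - g * w * (p1 + 2 * p2 * d + 3 * p3 * d^2 - d\<rho> * e0) + w * g * u *
           (p0 + p1 * d + p2 * d^2 + p3 * d^3 - \<rho> * e0)"
    using e ez e0z L(1) by algebra
  finally have *: "?L = \<dots>" .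
  \<comment> \<open>The second part of \<open>L\<close>, after dividing out the factor \<open>g\<close> that both of its sides contain.\<close>
  have "L1 * g = g * ((p1 - r1 * e0) - (p2 - r2 * e0) * g + p3 * g^2)"
    using L(2) unfolding ps rs e0[symmetric] by algebra
  then have L1: "L1 = (p1 - r1 * e0) - (p2 - r2 * e0) * g + p3 * g^2"
    using g by simp
  show ?thesis
    unfolding * using d u unfolding L1 \<rho> d\<rho> y e0[symmetric] by algebra
qed

text \<open>
  The pole \<open>1 / (z - s)\<close> has to move with speed \<open>(\<rho>'(s) u + \<rho>(s) u\<^sup>2) / M\<close>. In subcase A1, where
  \<open>s = t\<close> and \<open>M = \<rho>(t)\<close>, this is the time derivative of \<open>\<rho>(t) / (z - t)\<close> divided by \<open>\<rho>(t)\<close>. In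
  subcase Aq, where \<open>\<rho>(s) = 0\<close> and \<open>M = \<rho>'(s) t\<close>, it is \<open>u / t\<close>, the time derivative of
  \<open>t / (z - s)\<close> divided by \<open>t\<close>.
\<close>

lemma finite_eta_identity_pole:
  fixes M :: complex
  assumes d: "w * d = 1" and u: "u * y = 1" and y: "y = g + d" and r: "r * \<rho> = 1" and i: "i = u * r"
   and v: "v * g = 1"
   and \<rho>: "\<rho> = r0 + r1 * d + r2 * d^2"
   and rs: "rs = r0 - r1 * g + r2 * g^2" and drs: "drs = r1 - 2 * r2 * g"
   and st: "M * st = - rs * \<rho>"
   and d\<rho>: "d\<rho> = r1 + 2 * r2 * d"
   and s0: "s0 = g * r0" and s0z: "s0z = r0 + g * r1" and h: "h = g * r1"
   and G: "G = g * \<rho>" and G1: "G1 = g * d\<rho>" and sz: "sz = \<rho> + y * d\<rho>"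
   and e: "e = u" and e0: "e0 = v" and ez: "ez = - (u^2)" and e0z: "e0z = - (v^2)"
   and et: "Met = drs * u + rs * u^2" and e0t: "Me0t = drs * v + rs * v^2"
  shows "Met - Me0t + (h - s0z) * e0z - s0 * e0z * w - M * (e - e0) * st * i - 2 * (e - e0) * G1 * w
      + 2 * (e - e0) * G * w^2 - G * w * ez + (e - e0) * w * G * i * sz = 0" (is "?L = 0")
proof -
  have "M * st * i = - rs * u" "G * i * sz = g * (u * \<rho> + d\<rho>)"
    using r u st unfolding i G sz by algebra+
  moreover have uv: "u - v = - d * u * v" using u v y by algebra
  ultimately have "?L = - drs * d * u * v - rs * d * u * v * (u + v) + r0 * v^2 + r0 * v * w - d * u^2 * v * rs
     + d * u * v * g * d\<rho> * w - 2 * d * u * v * g * \<rho> * w^2 + g * \<rho> * w * u^2 - d * u * v * w * g * u * \<rho>"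
    unfolding e e0 ez e0z et e0t h s0z s0 G G1 using v by algebra
  also have "\<dots> = 0"
    using d u v unfolding rs drs \<rho> d\<rho> y by algebra
  finally show ?thesis .
qed

section \<open>The two families\<close>

context deformation_at
begin

text \<open>
  Subcases Bp and Bq: the quadratic coefficient of \<open>\<tau>\<close> and the cubic coefficient of \<open>\<sigma> \<eta>\<close>
  determine how fast \<open>\<tau>\<close> and \<open>\<eta>\<close> have to move.
\<close>

lemma hamilton_iff_compatible_infinity:
  assumes St: "St = 0" and G: "G = S" and h: "h = pderiv S"
    and S2: "degree S \<le> 2" and P2: "degree P \<le> 2"
    and Pt: "smult M Pt = smult (coeff P 2) S"
    and N: "product_is_poly S (\<eta> t) N" "degree N \<le> 3"
    and \<eta>t: "\<And>z. M * \<eta>t z = coeff N 3 * z"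
  shows "hamilton_iff_compatible_at \<sigma> \<tau> \<eta> a b H lam mu t"
proof -
  note S = poly_taylor2(1,2)[OF S2, of _ l0] poly_taylor2(3)[OF S2]
    and P = poly_taylor2(1,2)[OF P2, of _ l0]
  have MPt: "M * poly Pt z = coeff P 2 * poly S z" for z
    using arg_cong[OF Pt, of "\<lambda>p. poly p z"] by simp
  have N': "poly S z * \<eta> t z = poly N z"
    "poly S z * \<eta>z z + poly (pderiv S) z * \<eta> t z = poly (pderiv N) z" if "poly S z \<noteq> 0" for z
    using N(1) that product_is_poly_product_rule[OF N(1) that has_partials_fixed_t[OF \<eta>]]
    by (auto simp: product_is_poly_def \<sigma>_eq)
  have S0: "poly S l0 \<noteq> 0" using \<sigma>_nz by (simp add: \<sigma>_eq)
  obtain n2 where Nz: "\<And>z. poly N z = poly N l0 + poly (pderiv N) l0 * (z - l0) + n2 * (z - l0)\<^sup>2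
      + coeff N 3 * (z - l0) ^ 3"
    "\<And>z. poly (pderiv N) z = poly (pderiv N) l0 + 2 * n2 * (z - l0) + 3 * coeff N 3 * (z - l0)\<^sup>2"
    using poly_taylor3[OF N(2)] by blast
  show ?thesis
  proof (rule hamilton_iff_compatibility_at, unfold St G h poly_0 pderiv_0)
    fix z w i assume z: "poly S z \<noteq> 0" and w: "w * (z - l0) = 1" and i: "i * poly S z = 1"
    show "M * (poly Pt z * i - poly P z * 0 * i\<^sup>2) =
     (poly (pderiv P) z * poly S z * i + poly P z * poly (pderiv S) z * i
        - poly P z * poly S z * poly (pderiv S) z * i\<^sup>2 - poly (pderiv (pderiv S)) z) * w
     - (poly P z * poly S z * i - poly (pderiv S) z - poly P l0 + poly (pderiv S) l0) * w\<^sup>2"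
      by (rule infinity_first_identity[OF w i S(1) P(1) MPt P(2) S(2) S(3)])
  next
    fix z w i assume z: "poly S z \<noteq> 0" and w: "w * (z - l0) = 1" and i: "i * poly S z = 1"
    have "M * (\<eta>t z - \<eta>t l0) = coeff N 3 * (z - l0)"
      using \<eta>t by (simp add: algebra_simps)
    from infinity_eta_identity[OF w i S(1) S(2) N'[OF S0] _ _ this]
    show "M * (\<eta>t z - \<eta>t l0) + (poly (pderiv S) l0 - poly (pderiv S) l0) * \<eta>z l0 - poly S l0 * \<eta>z l0 * w
     - M * (\<eta> t z - \<eta> t l0) * 0 * i - 2 * (\<eta> t z - \<eta> t l0) * poly (pderiv S) z * w
     + 2 * (\<eta> t z - \<eta> t l0) * poly S z * w\<^sup>2 - poly S z * w * \<eta>z z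
     + (\<eta> t z - \<eta> t l0) * w * poly S z * i * poly (pderiv S) z = 0"
      using N'[OF z] Nz by metis
  next
    fix z w i Q1 assume z: "poly S z \<noteq> 0" and w: "w * (z - l0) = 1" and i: "i * poly S z = 1"
     and Q1: "Q1 = poly S l0 * w - (poly P l0 - poly (pderiv S) l0)"
    show "- M * (poly Pt l0 - 0)
     - (poly P l0 - poly (pderiv S) l0) * (poly (pderiv P) l0 - poly (pderiv (pderiv S)) l0)
     + (poly (pderiv P) l0 - poly (pderiv (pderiv S)) l0) * (poly P l0 - poly (pderiv S) l0)
     + w * (0 * M + poly (pderiv S) l0 * (poly P l0 - poly (pderiv S) l0)
         - (poly (pderiv P) l0 - poly (pderiv (pderiv S)) l0) * poly S l0)
     + poly S l0 * (poly P l0 - poly (pderiv S) l0) * w\<^sup>2 - M * Q1 * 0 * i + poly S l0 * poly P z * w\<^sup>2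
     - 3 * poly S z * poly S l0 * w ^ 3 - 2 * Q1 * poly (pderiv S) z * w + 2 * Q1 * poly S z * w\<^sup>2
     + poly S z * poly S l0 * w ^ 3 + Q1 * w * poly S z * i * poly (pderiv S) z = 0"
      by (rule infinity_tau_identity[OF w i S(1) P(1) MPt Q1 S(2) S(3)])
  next
    fix z w i assume z: "poly S z \<noteq> 0" and w: "w * (z - l0) = 1" and i: "i * poly S z = 1"
    show "- M * 0 + (poly (pderiv S) l0 - poly (pderiv S) l0) * poly (pderiv S) l0
     + 2 * poly S l0 * (poly (pderiv (pderiv S)) l0 - poly (pderiv (pderiv S)) l0)
     + w * poly S l0 * poly (pderiv S) l0 + 2 * (poly S l0)\<^sup>2 * w\<^sup>2 + M * poly S l0 * 0 * i
     + 2 * poly S l0 * poly (pderiv S) z * w - 2 * poly S l0 * poly S z * w\<^sup>2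
     - poly S l0 * w * poly S z * i * poly (pderiv S) z = 0"
      by (rule infinity_sigma_identity[OF w i S(1) S(2)])
  qed
qed

text \<open>
  Subcases A1, Ap and Aq. The hypothesis on \<open>L\<close> unites two situations: in A1 the regular part
  \<open>\<zeta>\<close> of \<open>\<eta>\<close> is itself a polynomial of degree at most one, whereas in Ap and Aq it may have
  poles, but \<open>\<rho>(s) = 0\<close> and \<open>L = 0\<close>.
\<close>

lemma hamilton_iff_compatible_finite:
  assumes S: "S = [:- s, 1:] * \<rho>" and \<rho>2: "degree \<rho> \<le> 2" and P2: "degree P \<le> 2"
    and G: "G = smult (l0 - s) \<rho>" and h: "h = [:- s, 1:] * pderiv \<rho>"
    and St: "smult M St = smult (- poly \<rho> s) \<rho>"
    and Pt: "[:- s, 1:] * smult M Pt = smult (poly P s) \<rho> - smult (poly \<rho> s) P"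
    and \<eta>_eq: "\<And>z. \<sigma> t z \<noteq> 0 \<Longrightarrow> \<eta> t z = \<alpha> / (z - s) + \<zeta> z"
    and \<eta>t: "\<And>z. \<sigma> t z \<noteq> 0 \<Longrightarrow> M * \<eta>t z = \<alpha> * (poly (pderiv \<rho>) s / (z - s) + poly \<rho> s / (z - s)\<^sup>2)"
    and N: "product_is_poly \<rho> \<zeta> N" "degree N \<le> 3"
    and L: "degree L \<le> 1" "poly N s = poly L s" "\<And>z. \<sigma> t z \<noteq> 0 \<Longrightarrow> poly \<rho> s * \<zeta> z = poly L z"
  shows "hamilton_iff_compatible_at \<sigma> \<tau> \<eta> a b H lam mu t"
proof -
  define g where "g = l0 - s"
  have Sz: "poly S z = (z - s) * poly \<rho> z"
    "poly (pderiv S) z = poly \<rho> z + (z - s) * poly (pderiv \<rho>) z"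
    "poly (pderiv (pderiv S)) z = 2 * poly (pderiv \<rho>) z + (z - s) * poly (pderiv (pderiv \<rho>)) z" for z
    by (simp_all add: S pderiv_mult pderiv_pCons pderiv_add algebra_simps del: mult_pCons_left mult_pCons_right)
  note \<rho> = poly_taylor2(1,2)[OF \<rho>2, of _ l0] poly_taylor2(3)[OF \<rho>2]
    and P = poly_taylor2(1,2)[OF P2, of _ l0]
  define r0 r1 r2 where r: "r0 = poly \<rho> l0" "r1 = poly (pderiv \<rho>) l0" "r2 = coeff \<rho> 2"
  have \<rho>s: "poly \<rho> s = r0 - r1 * g + r2 * g\<^sup>2" "poly (pderiv \<rho>) s = r1 - 2 * r2 * g"
    unfolding \<rho>[of s] g_def r by (simp_all add: algebra_simps power2_eq_square)
  have Ps: "poly P s = poly P l0 - poly (pderiv P) l0 * g + coeff P 2 * g\<^sup>2"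
    unfolding P(1)[of s] g_def by (simp add: algebra_simps power2_eq_square)
  have MSt: "M * poly St z = - poly \<rho> s * poly \<rho> z" "M * poly (pderiv St) z =
      - poly \<rho> s * poly (pderiv \<rho>) z" for z
    using arg_cong[OF St, of "\<lambda>p. poly p z"] arg_cong[OF St, of "\<lambda>p. poly (pderiv p) z"] by
        (simp_all add: pderiv_smult pderiv_minus)
  have MPt: "M * poly Pt z = (poly \<rho> z * poly P s - poly P z * poly \<rho> s) * u" if "u * (z - s) = 1" for z u
    using arg_cong[OF Pt, of "\<lambda>p. poly p z"] that by simp algebra
  have Gz: "poly G z = g * poly \<rho> z" "poly (pderiv G) z = g * poly (pderiv \<rho>) z"
    "poly (pderiv (pderiv G)) z = g * (2 * r2)" for z
    by (simp_all add: G g_def pderiv_smult \<rho>(3) r)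
  have h0: "poly h l0 = g * r1" "poly (pderiv h) l0 = r1 + 2 * g * r2"
    by (simp_all add: h g_def pderiv_mult pderiv_pCons \<rho>(3) r algebra_simps del: mult_pCons_left
        mult_pCons_right)
  have S0: "poly S l0 = g * r0" "poly (pderiv S) l0 = r0 + g * r1" "poly (pderiv (pderiv S)) l0 = 2 * r1
      + 2 * g * r2"
    using Sz[of l0] by (simp_all add: g_def \<rho>(3) r)
  have S0_nz: "poly S l0 \<noteq> 0" using \<sigma>_nz by (simp add: \<sigma>_eq)
  then have gv: "g \<noteq> 0" "1 / g * g = 1" "r0 \<noteq> 0" by (auto simp: S0)
  have Pt0: "M * poly Pt l0 = (r0 * poly P s - poly P l0 * poly \<rho> s) * (1 / g)"
    using MPt[of "1 / g" l0] gv by (simp add: g_def r)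
  have *: "\<exists>u r. u * (z - s) = 1 \<and> r * poly \<rho> z = 1 \<and> i = u * r \<and> z - s = g + (z - l0) \<and> \<sigma> t z \<noteq> 0"
    if "poly S z \<noteq> 0" "i * poly S z = 1" for z i
    using that by (intro exI[of _ "1 / (z - s)"] exI[of _ "1 / poly \<rho> z"])
        (auto simp: Sz(1) \<sigma>_eq g_def field_simps)
  show ?thesis
  proof (rule hamilton_iff_compatibility_at)
    fix z w i assume z: "poly S z \<noteq> 0" and w: "w * (z - l0) = 1" and i: "i * poly S z = 1"
    obtain u rr where u: "u * (z - s) = 1" "rr * poly \<rho> z = 1" "i = u * rr" "z - s = g + (z - l0)"
      using *[OF z i] by blast
    show "M * (poly Pt z * i - poly P z * poly St z * i\<^sup>2) =
     (poly (pderiv P) z * poly G z * i + poly P z * poly (pderiv G) z * i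
        - poly P z * poly G z * poly (pderiv S) z * i\<^sup>2 - poly (pderiv (pderiv G)) z) * w
     - (poly P z * poly G z * i - poly (pderiv G) z - poly P l0 + poly h l0) * w\<^sup>2"
      by (rule finite_first_identity[OF w u(1) u(4) u(2) u(3) P(1) Ps P(2) MPt[OF u(1)] MSt(1)
          \<rho>(2)[folded r] Gz Sz(2) h0(1)])
  next
    fix z w i assume z: "poly S z \<noteq> 0" and w: "w * (z - l0) = 1" and i: "i * poly S z = 1"
    obtain u rr where u: "u * (z - s) = 1" "rr * poly \<rho> z = 1" "i = u * rr" "z - s = g + (z - l0)" and s:
        "\<sigma> t z \<noteq> 0"
      using *[OF z i] by blast
    have uz: "1 / (z - s) = u" and vz: "1 / (l0 - s) = 1 / g"
      using u(1,2) by (auto simp: g_def divide_eq_eq)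
    define \<zeta>' where "\<zeta>' z = (poly (pderiv N) z - poly (pderiv \<rho>) z * \<zeta> z) / poly \<rho> z" for z
    have \<zeta>: "poly \<rho> z * \<zeta> z = poly N z" "poly \<rho> z * \<zeta>' z + poly (pderiv \<rho>) z * \<zeta> z = poly (pderiv N) z"
      "\<eta>z z = \<alpha> * (- ((1 / (z - s))\<^sup>2)) + \<zeta>' z" "\<eta> t z = \<alpha> * (1 / (z - s)) + \<zeta> z"
      "M * \<eta>t z = \<alpha> * (poly (pderiv \<rho>) s * (1 / (z - s)) + poly \<rho> s * (1 / (z - s))\<^sup>2)"
      if z: "\<sigma> t z \<noteq> 0" for z
    proof -
      have z': "poly \<rho> z \<noteq> 0" "z \<noteq> s" using z by (auto simp: \<sigma>_eq Sz)
      show "poly \<rho> z * \<zeta> z = poly N z"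
        using N(1) z' by (simp add: product_is_poly_def)
      show "poly \<rho> z * \<zeta>' z + poly (pderiv \<rho>) z * \<zeta> z = poly (pderiv N) z"
        using z' by (simp add: \<zeta>'_def)
      show "\<eta> t z = \<alpha> * (1 / (z - s)) + \<zeta> z"
        using \<eta>_eq[OF z] by simp
      show "M * \<eta>t z = \<alpha> * (poly (pderiv \<rho>) s * (1 / (z - s)) + poly \<rho> s * (1 / (z - s))\<^sup>2)"
        using \<eta>t[OF z] by (simp add: power_divide)
      have "\<forall>\<^sub>F x in nhds z. poly S x \<noteq> 0"
        using z by (intro tendsto_imp_eventually_ne[where c = "poly S z"] tendsto_intros filterlim_ident)
            (simp add: \<sigma>_eq)
      then have ev: "\<forall>\<^sub>F x in nhds z. \<alpha> * (1 / (x - s)) + \<zeta> x = \<eta> t x"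
        by eventually_elim (simp add: \<eta>_eq \<sigma>_eq)
      have "((\<lambda>x. \<alpha> * (1 / (x - s)) + \<zeta> x) has_field_derivative \<alpha> * (- ((1 / (z - s))\<^sup>2)) + \<zeta>' z) (at z)"
        unfolding \<zeta>'_def
        by (intro DERIV_add DERIV_cmult product_is_poly_deriv[OF N(1)] z')
           (use z' in \<open>auto intro!: derivative_eq_intros simp: power2_eq_square divide_simps\<close>)
      then have "(\<eta> t has_field_derivative \<alpha> * (- ((1 / (z - s))\<^sup>2)) + \<zeta>' z) (at z)"
        using DERIV_cong_ev[OF refl ev refl] by simp
      then show "\<eta>z z = \<alpha> * (- ((1 / (z - s))\<^sup>2)) + \<zeta>' z"
        using DERIV_unique has_partials_fixed_t[OF \<eta>[OF z]] by blast
    qed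
    obtain n2 where Nz: "\<And>z. poly N z = poly N l0 + poly (pderiv N) l0 * (z - l0) + n2 * (z - l0)\<^sup>2
        + coeff N 3 * (z - l0) ^ 3"
      "\<And>z. poly (pderiv N) z = poly (pderiv N) l0 + 2 * n2 * (z - l0) + 3 * coeff N 3 * (z - l0)\<^sup>2"
      using poly_taylor3[OF N(2)] by blast
    have Ns: "poly N s = poly N l0 - poly (pderiv N) l0 * g + n2 * g\<^sup>2 - coeff N 3 * g ^ 3"
      unfolding Nz(1)[of s] g_def by algebra
    have Lz: "poly L x = coeff L 0 + coeff L 1 * x" for x
      using L(1) by (subst poly_altdef) (auto simp: le_Suc_eq coeff_eq_0)
    have L': "poly \<rho> s * (\<zeta> z - \<zeta> l0) = coeff L 1 * (z - l0)" "poly N s - poly \<rho> s * \<zeta> l0 = - coeff L 1 * g"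
      using L(2) L(3)[OF s] L(3)[OF \<sigma>_nz] unfolding Lz g_def by (simp_all add: algebra_simps)
    note \<zeta>z = \<zeta>[OF s, unfolded uz] and \<zeta>0 = \<zeta>[OF \<sigma>_nz, unfolded vz]
    have reg: "(poly h l0 - poly (pderiv S) l0) * \<zeta>' l0 - poly S l0 * \<zeta>' l0 * w
     - M * (\<zeta> z - \<zeta> l0) * poly St z * i - 2 * (\<zeta> z - \<zeta> l0) * poly (pderiv G) z * w
     + 2 * (\<zeta> z - \<zeta> l0) * poly G z * w\<^sup>2 - poly G z * w * \<zeta>' z
     + (\<zeta> z - \<zeta> l0) * w * poly G z * i * poly (pderiv S) z = 0"
      by (rule finite_eta_identity_regular[OF w u(1) u(4) u(2) u(3) gv(1) \<rho>(1)[folded r] \<rho>s(1) MSt(1)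
          \<rho>(2)[folded r]
            S0(1,2) h0(1) Gz(1,2) Sz(2) \<zeta>0(1)[folded r] \<zeta>0(2)[folded r] \<zeta>z(1)[unfolded Nz(1)[of z]]
                \<zeta>z(2)[unfolded Nz(2)[of z]] Ns L'])
    have pole: "(poly (pderiv \<rho>) s * u + poly \<rho> s * u\<^sup>2) - (poly (pderiv \<rho>) s * (1 / g) + poly \<rho> s * (1 / g)\<^sup>2)
     + (poly h l0 - poly (pderiv S) l0) * (- ((1 / g)\<^sup>2)) - poly S l0 * (- ((1 / g)\<^sup>2)) * w
     - M * (u - 1 / g) * poly St z * i - 2 * (u - 1 / g) * poly (pderiv G) z * w
     + 2 * (u - 1 / g) * poly G z * w\<^sup>2 - poly G z * w * (- (u\<^sup>2))
     + (u - 1 / g) * w * poly G z * i * poly (pderiv S) z = 0"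
      by (rule finite_eta_identity_pole[OF w u(1) u(4) u(2) u(3) gv(2) \<rho>(1)[folded r] \<rho>s MSt(1) \<rho>(2)[folded r]
            S0(1,2) h0(1) Gz(1,2) Sz(2) refl refl refl refl refl refl])
    show "M * (\<eta>t z - \<eta>t l0) + (poly h l0 - poly (pderiv S) l0) * \<eta>z l0 - poly S l0 * \<eta>z l0 * w
     - M * (\<eta> t z - \<eta> t l0) * poly St z * i - 2 * (\<eta> t z - \<eta> t l0) * poly (pderiv G) z * w
     + 2 * (\<eta> t z - \<eta> t l0) * poly G z * w\<^sup>2 - poly G z * w * \<eta>z z
     + (\<eta> t z - \<eta> t l0) * w * poly G z * i * poly (pderiv S) z = 0"
      unfolding right_diff_distrib[of M "\<eta>t z"] \<zeta>z(3-5) \<zeta>0(3-5)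
      using reg pole by algebra
  next
    fix z w i Q1 assume z: "poly S z \<noteq> 0" and w: "w * (z - l0) = 1" and i: "i * poly S z = 1"
     and Q1: "Q1 = poly S l0 * w - (poly P l0 - poly (pderiv S) l0)"
    obtain u rr where u: "u * (z - s) = 1" "rr * poly \<rho> z = 1" "i = u * rr" "z - s = g + (z - l0)"
      using *[OF z i] by blast
    show "- M * (poly Pt l0 - poly (pderiv St) l0)
     - (poly P l0 - poly h l0) * (poly (pderiv P) l0 - poly (pderiv (pderiv S)) l0)
     + (poly (pderiv P) l0 - poly (pderiv h) l0) * (poly P l0 - poly (pderiv S) l0)
     + w * (poly St l0 * M + poly (pderiv S) l0 * (poly P l0 - poly h l0)
         - (poly (pderiv P) l0 - poly (pderiv h) l0) * poly S l0)
     + poly S l0 * (poly P l0 - poly h l0) * w\<^sup>2 - M * Q1 * poly St z * i + poly S l0 * poly P z * w\<^sup>2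
     - 3 * poly S z * poly S l0 * w ^ 3 - 2 * Q1 * poly (pderiv G) z * w + 2 * Q1 * poly G z * w\<^sup>2
     + poly G z * poly S l0 * w ^ 3 + Q1 * w * poly G z * i * poly (pderiv S) z = 0"
      by (rule finite_tau_identity[OF w u(1) u(4) u(2) u(3) gv(2) \<rho>(1)[folded r] \<rho>s(1) P(1) Ps Pt0 MSt(1)
            MSt(1)[of l0, folded r] MSt(2)[of l0, folded r] \<rho>(2)[folded r] Sz(1) S0 h0 Gz(1,2) Sz(2) Q1])
  next
    fix z w i assume z: "poly S z \<noteq> 0" and w: "w * (z - l0) = 1" and i: "i * poly S z = 1"
    obtain u rr where u: "u * (z - s) = 1" "rr * poly \<rho> z = 1" "i = u * rr" "z - s = g + (z - l0)"
      using *[OF z i] by blast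
    show "- M * poly St l0 + (poly h l0 - poly (pderiv S) l0) * poly (pderiv S) l0
     + 2 * poly S l0 * (poly (pderiv (pderiv S)) l0 - poly (pderiv h) l0)
     + w * poly S l0 * poly (pderiv S) l0 + 2 * (poly S l0)\<^sup>2 * w\<^sup>2 + M * poly S l0 * poly St z * i
     + 2 * poly S l0 * poly (pderiv G) z * w - 2 * poly S l0 * poly G z * w\<^sup>2
     - poly S l0 * w * poly G z * i * poly (pderiv S) z = 0"
      by (rule finite_sigma_identity[OF w u(1) u(4) u(2) u(3) \<rho>(1)[folded r] \<rho>s(1) MSt(1)
          MSt(1)[of l0, folded r]
            \<rho>(2)[folded r] S0 h0 Gz(1,2) Sz(2)])
  qed
qed

end

section \<open>The five subcases\<close>

lemma deriv_poly: "deriv (poly p) z = poly (pderiv p) z"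
  by (rule DERIV_imp_deriv[OF poly_DERIV])

text \<open>
  The number \<open>M\<close> is the quadratic coefficient of \<open>\<tau>\<close>, and \<open>\<sigma> \<eta>\<close> has no cubic term.
\<close>

lemma subcase_Bp_at:
  assumes subcase: "subcase_Bp T \<sigma> \<tau> \<eta> a b H" and t: "t \<in> T"
    and lam: "lam field_differentiable at t" and mu: "mu field_differentiable at t"
    and nz: "\<sigma> t (lam t) \<noteq> 0"
  shows "hamilton_iff_compatible_at \<sigma> \<tau> \<eta> a b H lam mu t"
proof -
  obtain \<sigma>0 \<tau>0 \<eta>0 N M where
    "\<sigma>0 \<noteq> 0" and deg: "degree \<sigma>0 \<le> 2" "degree \<tau>0 \<le> 2" and N: "product_is_poly \<sigma>0 \<eta>0 N" "degree N \<le> 2"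
    and \<sigma>: "\<forall>t z. \<sigma> t z = poly \<sigma>0 z" and \<tau>: "\<forall>t z. \<tau> t z = t * poly \<sigma>0 z + poly \<tau>0 z"
    and \<eta>: "\<forall>t z. \<eta> t z = \<eta>0 z"
    and "(pderiv ^^ 2) \<sigma>0 \<noteq> 0 \<or> (pderiv ^^ 2) \<tau>0 \<noteq> 0"
    and M: "\<forall>t. M t = t * poly ((pderiv ^^ 2) \<sigma>0) 0 / 2 + poly ((pderiv ^^ 2) \<tau>0) 0 / 2" "\<forall>t\<in>T. M t \<noteq> 0"
    and a: "\<forall>t\<in>T. \<forall>l m z. a t l m z = poly \<sigma>0 z / (M t * (z - l))"
    and b: "\<forall>t\<in>T. \<forall>l m z. b t l m z = - (poly \<sigma>0 l * m / (M t * (z - l)))"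
    and H: "\<forall>t\<in>T. \<forall>l m. M t * H t l m = poly \<sigma>0 l * m\<^sup>2
            + (t * poly \<sigma>0 l + poly \<tau>0 l - poly (pderiv \<sigma>0) l) * m + \<eta>0 l"
    using subcase unfolding subcase_Bp_def by (elim exE conjE) (rule that; assumption)
  note \<sigma> = \<sigma>[rule_format] and \<tau> = \<tau>[rule_format] and \<eta> = \<eta>[rule_format]
    and M = M(1)[rule_format, of t] M(2)[rule_format, OF t]
    and a = a[rule_format, OF t] and b = b[rule_format, OF t] and H = H[rule_format, OF t]
  have \<sigma>': "\<sigma> u = poly \<sigma>0" for u using \<sigma> by auto
  have \<eta>': "\<eta> = (\<lambda>_. \<eta>0)" using \<eta> by auto
  define \<eta>z where "\<eta>z z = (poly (pderiv N) z - poly (pderiv \<sigma>0) z * \<eta>0 z) / poly \<sigma>0 z" for z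
  interpret D: deformation_at \<sigma> \<tau> \<eta> a b H lam mu t "M t" \<sigma>0 0 "smult t \<sigma>0 + \<tau>0" \<sigma>0 \<sigma>0 "pderiv \<sigma>0"
    "\<lambda>_. 0" \<eta>z
  proof
    fix z
    show "has_partials \<sigma> (poly 0 z) (poly (pderiv \<sigma>0) z) t z"
      by (rule has_partials_cong[OF has_partials_poly]) (simp_all add: \<sigma>)
    show "has_partials (\<lambda>u. deriv (\<sigma> u)) (poly (pderiv 0) (lam t)) (poly (pderiv (pderiv \<sigma>0)) (lam t)) t
        (lam t)"
      by (rule has_partials_cong[OF has_partials_poly]) (simp_all add: \<sigma>' deriv_poly)
    show "has_partials \<tau> (poly \<sigma>0 z) (poly (pderiv (smult t \<sigma>0 + \<tau>0)) z) t z"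
      by (rule has_partials_cong[OF
          has_partials_add[OF has_partials_mult[OF has_partials_time has_partials_poly]
            has_partials_poly]]) (simp_all add: \<tau> pderiv_add pderiv_smult)
    show "has_partials \<eta> 0 (\<eta>z z) t z" if "\<sigma> t z \<noteq> 0"
      unfolding \<eta>' \<eta>z_def using that by (intro has_partials_of_z product_is_poly_deriv[OF N(1)]) (simp add: \<sigma>)
  qed (use lam mu M(2) nz in \<open>simp_all add: \<sigma> \<tau> \<eta> a b H\<close>)
  have Mt: "coeff (smult t \<sigma>0 + \<tau>0) 2 = M t"
    unfolding M by (simp add: numeral_2_eq_2 poly_0_coeff_0 coeff_pderiv)
  have Pt: "smult (M t) \<sigma>0 = smult (coeff (smult t \<sigma>0 + \<tau>0) 2) \<sigma>0"
    by (simp only: Mt)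
  have "degree (smult t \<sigma>0 + \<tau>0) \<le> 2"
    using deg by (intro degree_add_le) (auto intro: order_trans[OF degree_smult_le])
  moreover have "product_is_poly \<sigma>0 (\<eta> t) N" "degree N \<le> 3"
    using N by (simp_all add: \<eta>')
  moreover have "M t * 0 = coeff N 3 * z" for z
    using N(2) by (simp add: coeff_eq_0)
  ultimately show ?thesis
    by (rule D.hamilton_iff_compatible_infinity[OF refl refl refl deg(1) _ Pt])
qed

text \<open>
  The number \<open>M\<close> is the cubic coefficient of \<open>\<sigma> \<eta>\<close>, to which both \<open>t z\<close> and \<open>\<eta>\<^sub>0\<close> contribute.
\<close>

lemma subcase_Bq_at:
  assumes subcase: "subcase_Bq T \<sigma> \<tau> \<eta> a b H" and t: "t \<in> T"
    and lam: "lam field_differentiable at t" and mu: "mu field_differentiable at t"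
    and nz: "\<sigma> t (lam t) \<noteq> 0"
  shows "hamilton_iff_compatible_at \<sigma> \<tau> \<eta> a b H lam mu t"
proof -
  obtain \<sigma>0 \<tau>0 \<eta>0 N M where
    "\<sigma>0 \<noteq> 0" and deg: "degree \<sigma>0 \<le> 2" "degree \<tau>0 \<le> 1" and N: "product_is_poly \<sigma>0 \<eta>0 N" "degree N \<le> 3"
    and \<sigma>: "\<forall>t z. \<sigma> t z = poly \<sigma>0 z" and \<tau>: "\<forall>t z. \<tau> t z = poly \<tau>0 z"
    and \<eta>: "\<forall>t z. \<eta> t z = t * z + \<eta>0 z"
    and "(pderiv ^^ 2) \<sigma>0 \<noteq> 0 \<or> (pderiv ^^ 3) N \<noteq> 0"
    and M: "\<forall>t. M t = t * poly ((pderiv ^^ 2) \<sigma>0) 0 / 2 + poly ((pderiv ^^ 3) N) 0 / 6" "\<forall>t\<in>T. M t \<noteq> 0"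
    and a: "\<forall>t\<in>T. \<forall>l m z. a t l m z = poly \<sigma>0 z / (M t * (z - l))"
    and b: "\<forall>t\<in>T. \<forall>l m z. b t l m z = - (poly \<sigma>0 l * m / (M t * (z - l)))"
    and H: "\<forall>t\<in>T. \<forall>l m. M t * H t l m = poly \<sigma>0 l * m\<^sup>2
            + (poly \<tau>0 l - poly (pderiv \<sigma>0) l) * m + t * l + \<eta>0 l"
    using subcase unfolding subcase_Bq_def by (elim exE conjE) (rule that; assumption)
  note \<sigma> = \<sigma>[rule_format] and \<tau> = \<tau>[rule_format] and \<eta> = \<eta>[rule_format]
    and M = M(1)[rule_format, of t] M(2)[rule_format, OF t]
    and a = a[rule_format, OF t] and b = b[rule_format, OF t] and H = H[rule_format, OF t]
  have \<sigma>': "\<sigma> u = poly \<sigma>0" for u using \<sigma> by auto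
  define \<eta>z where "\<eta>z z = t + (poly (pderiv N) z - poly (pderiv \<sigma>0) z * \<eta>0 z) / poly \<sigma>0 z" for z
  interpret D: deformation_at \<sigma> \<tau> \<eta> a b H lam mu t "M t" \<sigma>0 0 \<tau>0 0 \<sigma>0 "pderiv \<sigma>0"
    "\<lambda>z. z" \<eta>z
  proof
    fix z
    show "has_partials \<sigma> (poly 0 z) (poly (pderiv \<sigma>0) z) t z"
      by (rule has_partials_cong[OF has_partials_poly]) (simp_all add: \<sigma>)
    show "has_partials (\<lambda>u. deriv (\<sigma> u)) (poly (pderiv 0) (lam t)) (poly (pderiv (pderiv \<sigma>0)) (lam t)) t
        (lam t)"
      by (rule has_partials_cong[OF has_partials_poly]) (simp_all add: \<sigma>' deriv_poly)
    show "has_partials \<tau> (poly 0 z) (poly (pderiv \<tau>0) z) t z"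
      by (rule has_partials_cong[OF has_partials_poly]) (simp_all add: \<tau>)
    show "has_partials \<eta> z (\<eta>z z) t z" if "\<sigma> t z \<noteq> 0"
      by (rule has_partials_cong[OF
          has_partials_add[OF has_partials_mult[OF has_partials_time has_partials_of_z[OF DERIV_ident]]
            has_partials_of_z[OF product_is_poly_deriv[OF N(1)]]]])
         (use that in \<open>simp_all add: \<sigma> \<eta> \<eta>z_def\<close>)
  qed (use lam mu M(2) nz in \<open>simp_all add: \<sigma> \<tau> \<eta> a b H\<close>)
  let ?N = "smult t ([:0, 1:] * \<sigma>0) + N"
  have Mt: "coeff ?N 3 = M t"
    unfolding M by (simp add: numeral_2_eq_2 numeral_3_eq_3 poly_0_coeff_0 coeff_pderiv)
  have "degree ?N \<le> 3"
    using deg N(2) by (intro degree_add_le order_trans[OF degree_smult_le] order_trans[OF degree_mult_le]) auto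
  moreover have "product_is_poly \<sigma>0 (\<eta> t) ?N"
    using N(1) by (simp add: product_is_poly_def \<eta> algebra_simps)
  moreover have "degree \<tau>0 \<le> 2" "smult (M t) 0 = smult (coeff \<tau>0 2) \<sigma>0"
    using deg(2) by (simp_all add: coeff_eq_0)
  moreover have "M t * z = coeff ?N 3 * z" for z
    by (simp only: Mt)
  ultimately show ?thesis
    by (intro D.hamilton_iff_compatible_infinity[OF refl refl refl deg(1)])
qed

lemma degree_mult_le_sum:
  assumes "degree p \<le> m" "degree q \<le> n" "m + n \<le> k"
  shows "degree (p * q :: complex poly) \<le> k"
  using order_trans[OF degree_mult_le[of p q]] assms by simp

text \<open>
  The singular point itself moves, \<open>s = t\<close>, and \<open>M = \<rho>(t)\<close>. The residue of \<open>\<eta>\<close> at \<open>s\<close> is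
  \<open>\<alpha> \<rho>(t)\<close>.
\<close>

lemma subcase_A1_at:
  assumes subcase: "subcase_A1 T \<sigma> \<tau> \<eta> a b H" and t: "t \<in> T"
    and lam: "lam field_differentiable at t" and mu: "mu field_differentiable at t"
    and nz: "\<sigma> t (lam t) \<noteq> 0"
  shows "hamilton_iff_compatible_at \<sigma> \<tau> \<eta> a b H lam mu t"
proof -
  obtain \<rho> \<phi> \<eta>0 \<kappa> \<alpha> where
    deg: "degree \<rho> \<le> 2" "degree \<phi> \<le> 1" "degree \<eta>0 \<le> 1"
    and \<sigma>: "\<forall>t z. \<sigma> t z = (z - t) * poly \<rho> z"
    and \<tau>: "\<forall>t z. \<tau> t z = (1 - \<kappa>) * poly \<rho> z + poly \<phi> z * (z - t)"
    and \<eta>: "\<forall>t z. \<eta> t z = \<alpha> * poly \<rho> t / (z - t) + poly \<eta>0 z"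
    and M: "\<forall>t\<in>T. poly \<rho> t \<noteq> 0"
    and a: "\<forall>t\<in>T. \<forall>l m z. a t l m z = (l - t) * poly \<rho> z / (poly \<rho> t * (z - l))"
    and b: "\<forall>t\<in>T. \<forall>l m z. b t l m z = - (\<sigma> t l * m / (poly \<rho> t * (z - l)))"
    and H: "\<forall>t\<in>T. \<forall>l m. poly \<rho> t * H t l m = (l - t) * poly \<rho> l * m\<^sup>2
            + ((1 - \<kappa>) * poly \<rho> l + (l - t) * (poly \<phi> l - poly (pderiv \<rho>) l)) * m
            + \<alpha> * poly \<rho> t / (l - t) + poly \<eta>0 l"
    using subcase unfolding subcase_A1_def by (elim exE conjE) (rule that; assumption)
  note \<sigma> = \<sigma>[rule_format] and \<tau> = \<tau>[rule_format] and \<eta> = \<eta>[rule_format]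
    and M = M[rule_format, OF t]
    and a = a[rule_format, OF t] and b = b[rule_format, OF t] and H = H[rule_format, OF t]
  define S P where "S = [:- t, 1:] * \<rho>" and "P = smult (1 - \<kappa>) \<rho> + \<phi> * [:- t, 1:]"
  have S: "poly S z = (z - t) * poly \<rho> z" "poly (pderiv S) z = poly \<rho> z + (z - t) * poly (pderiv \<rho>) z"
    "poly (pderiv (pderiv S)) z = 2 * poly (pderiv \<rho>) z + (z - t) * poly (pderiv (pderiv \<rho>)) z" for z
    by (simp_all add: S_def pderiv_mult pderiv_pCons pderiv_add algebra_simps del: mult_pCons_left
        mult_pCons_right)
  have P: "poly P z = (1 - \<kappa>) * poly \<rho> z + poly \<phi> z * (z - t)"
    "poly (pderiv P) z = (1 - \<kappa>) * poly (pderiv \<rho>) z + poly (pderiv \<phi>) z * (z - t) + poly \<phi> z" for z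
    by (simp_all add: P_def pderiv_mult pderiv_pCons pderiv_add pderiv_smult algebra_simps del:
        mult_pCons_left mult_pCons_right)
  have \<sigma>': "deriv (\<sigma> u) v = poly \<rho> v + (v + (- u)) * poly (pderiv \<rho>) v" for u v
    unfolding \<sigma>[abs_def] by (rule DERIV_imp_deriv) (auto intro!: derivative_eq_intros)
  have diff: "has_partials (\<lambda>u v. v + (- u)) (0 + (- 1)) (1 + 0) t z" for z
    by (intro has_partials_add has_partials_of_z has_partials_of_t derivative_intros)
  define \<eta>t \<eta>z where "\<eta>t z = \<alpha> * (poly (pderiv \<rho>) t / (z - t) + poly \<rho> t / (z - t)\<^sup>2)"
    and "\<eta>z z = poly (pderiv \<eta>0) z - \<alpha> * poly \<rho> t / (z - t)\<^sup>2" for z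
  interpret D: deformation_at \<sigma> \<tau> \<eta> a b H lam mu t "poly \<rho> t" S "- \<rho>" P "- \<phi>" "smult (lam t - t) \<rho>"
    "[:- t, 1:] * pderiv \<rho>" \<eta>t \<eta>z
  proof
    fix z
    show "has_partials \<sigma> (poly (- \<rho>) z) (poly (pderiv S) z) t z"
      by (rule has_partials_cong[OF has_partials_mult[OF diff has_partials_poly]])
         (simp_all add: \<sigma> S algebra_simps)
    show "has_partials (\<lambda>u. deriv (\<sigma> u)) (poly (pderiv (- \<rho>)) (lam t)) (poly (pderiv (pderiv S)) (lam t))
        t (lam t)"
    proof (rule has_partials_cong[OF
        has_partials_add[OF has_partials_poly has_partials_mult[OF diff has_partials_poly]]])
      show "poly (pderiv \<rho>) (lam t) + ((1 + 0) * poly (pderiv \<rho>) (lam t)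
          + (lam t + - t) * poly (pderiv (pderiv \<rho>)) (lam t)) = poly (pderiv (pderiv S)) (lam t)"
        unfolding S by algebra
    qed (simp_all add: \<sigma>' pderiv_minus)
    show "has_partials \<tau> (poly (- \<phi>) z) (poly (pderiv P) z) t z"
      by (rule has_partials_cong[OF has_partials_add[OF has_partials_poly[of "smult (1 - \<kappa>) \<rho>"]
            has_partials_mult[OF has_partials_poly diff]]])
         (simp_all add: \<tau> P pderiv_smult algebra_simps)
    show "has_partials \<eta> (\<eta>t z) (\<eta>z z) t z" if "\<sigma> t z \<noteq> 0"
    proof (rule has_partials_cong[OF
        has_partials_add[OF has_partials_mult[OF has_partials_of_t[OF DERIV_cmult[OF poly_DERIV]]
            has_partials_moving_pole] has_partials_poly]])
      show "z \<noteq> t" using that by (auto simp: \<sigma>)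
      then show "\<alpha> * poly (pderiv \<rho>) t * (1 / (z - t)) + \<alpha> * poly \<rho> t * (1 / (z - t)\<^sup>2) + 0 = \<eta>t z"
        "0 * (1 / (z - t)) + \<alpha> * poly \<rho> t * - (1 / (z - t)\<^sup>2) + poly (pderiv \<eta>0) z = \<eta>z z"
        by (simp_all add: \<eta>t_def \<eta>z_def algebra_simps)
    qed (simp add: \<eta>)
  qed (use lam mu M nz in \<open>simp_all add: \<sigma> \<tau> \<eta> a b H S P pderiv_smult algebra_simps\<close>)
  show ?thesis
  proof (rule D.hamilton_iff_compatible_finite[where \<alpha> = "\<alpha> * poly \<rho> t"])
    show "S = [:- t, 1:] * \<rho>" by (rule S_def)
    show "degree P \<le> 2"
      unfolding P_def using deg
      by (intro degree_add_le degree_mult_le_sum[where m = 1 and n = 1] order_trans[OF degree_smult_le]) auto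
    show "[:- t, 1:] * smult (poly \<rho> t) (- \<phi>) = smult (poly P t) \<rho> - smult (poly \<rho> t) P"
      unfolding P(1) by (rule poly_ext) (simp add: P algebra_simps)
    show "product_is_poly \<rho> (poly \<eta>0) (\<rho> * \<eta>0)" by (simp add: product_is_poly_def)
    show "degree (\<rho> * \<eta>0) \<le> 3" using deg by (intro degree_mult_le_sum) auto
    show "degree (smult (poly \<rho> t) \<eta>0) \<le> 1" using deg by (intro order_trans[OF degree_smult_le])
  qed (use deg in \<open>simp_all add: \<eta> \<eta>t_def algebra_simps\<close>)
qed

text \<open>
  The multiple zero \<open>s\<close> is fixed and \<open>\<rho> = (z - s) \<rho>\<^sub>1\<close>. Since \<open>\<rho>(s) = 0\<close>, the speed of \<open>\<tau>\<close>
  required at a finite singular point is \<open>\<tau>(s) \<rho>\<^sub>1 / M\<close>, which is \<open>\<rho>\<^sub>1\<close> because \<open>M = \<tau>(s)\<close>.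
\<close>

lemma subcase_Ap_at:
  assumes subcase: "subcase_Ap T \<sigma> \<tau> \<eta> a b H" and t: "t \<in> T"
    and lam: "lam field_differentiable at t" and mu: "mu field_differentiable at t"
    and nz: "\<sigma> t (lam t) \<noteq> 0"
  shows "hamilton_iff_compatible_at \<sigma> \<tau> \<eta> a b H lam mu t"
proof -
  obtain s \<rho>1 \<tau>0 \<psi> M where
    "\<rho>1 \<noteq> 0" and deg: "degree \<rho>1 \<le> 1" "degree \<tau>0 \<le> 2" "degree \<psi> \<le> 2"
    and \<sigma>: "\<forall>t z. \<sigma> t z = (z - s)\<^sup>2 * poly \<rho>1 z"
    and \<tau>: "\<forall>t z. \<tau> t z = t * poly \<rho>1 z + poly \<tau>0 z"
    and \<eta>: "\<forall>t z. \<eta> t z = poly \<psi> z / poly \<rho>1 z"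
    and "poly \<tau>0 s \<noteq> 0 \<or> poly \<rho>1 s \<noteq> 0"
    and M: "\<forall>t. M t = poly \<tau>0 s + t * poly \<rho>1 s" "\<forall>t\<in>T. M t \<noteq> 0"
    and a: "\<forall>t\<in>T. \<forall>l m z. a t l m z = (l - s) * (z - s) * poly \<rho>1 z / (M t * (z - l))"
    and b: "\<forall>t\<in>T. \<forall>l m z. b t l m z = - ((l - s)\<^sup>2 * poly \<rho>1 l * m / (M t * (z - l)))"
    and H: "\<forall>t\<in>T. \<forall>l m. M t * H t l m = (l - s)\<^sup>2 * poly \<rho>1 l * m\<^sup>2
            + (t * poly \<rho>1 l + poly \<tau>0 l - (l - s) * poly \<rho>1 l - (l - s)\<^sup>2 * poly (pderiv \<rho>1) l) * m
            + poly \<psi> l / poly \<rho>1 l"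
    using subcase unfolding subcase_Ap_def by (elim exE conjE) (rule that; assumption)
  note \<sigma> = \<sigma>[rule_format] and \<tau> = \<tau>[rule_format] and \<eta> = \<eta>[rule_format]
    and M = M(1)[rule_format, of t] M(2)[rule_format, OF t]
    and a = a[rule_format, OF t] and b = b[rule_format, OF t] and H = H[rule_format, OF t]
  define \<rho> S P where "\<rho> = [:- s, 1:] * \<rho>1" and "S = [:- s, 1:] * \<rho>" and "P = smult t \<rho>1 + \<tau>0"
  have \<rho>: "poly \<rho> z = (z - s) * poly \<rho>1 z" "poly (pderiv \<rho>) z = poly \<rho>1 z + (z - s) * poly (pderiv \<rho>1) z" for z
    by (simp_all add: \<rho>_def pderiv_mult pderiv_pCons algebra_simps del: mult_pCons_left mult_pCons_right)
  have S: "poly S z = (z - s)\<^sup>2 * poly \<rho>1 z" for z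
    by (simp add: S_def \<rho> power2_eq_square algebra_simps)
  have \<sigma>': "\<sigma> u = poly S" for u using \<sigma> S by auto
  have N: "product_is_poly \<rho>1 (\<eta> u) \<psi>" for u
    by (simp add: product_is_poly_def \<eta>)
  have \<eta>': "\<eta> = (\<lambda>_. \<eta> t)" using \<eta> by (auto simp: fun_eq_iff)
  define \<eta>z where "\<eta>z z = (poly (pderiv \<psi>) z - poly (pderiv \<rho>1) z * \<eta> t z) / poly \<rho>1 z" for z
  interpret D: deformation_at \<sigma> \<tau> \<eta> a b H lam mu t "M t" S 0 P \<rho>1 "smult (lam t - s) \<rho>"
    "[:- s, 1:] * pderiv \<rho>" "\<lambda>_. 0" \<eta>z
  proof
    fix z
    show "has_partials \<sigma> (poly 0 z) (poly (pderiv S) z) t z"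
      by (rule has_partials_cong[OF has_partials_poly]) (simp_all add: \<sigma>')
    show "has_partials (\<lambda>u. deriv (\<sigma> u)) (poly (pderiv 0) (lam t)) (poly (pderiv (pderiv S)) (lam t)) t (lam t)"
      by (rule has_partials_cong[OF has_partials_poly]) (simp_all add: \<sigma>' deriv_poly)
    show "has_partials \<tau> (poly \<rho>1 z) (poly (pderiv P) z) t z"
      by (rule has_partials_cong[OF
          has_partials_add[OF has_partials_mult[OF has_partials_time has_partials_poly]
            has_partials_poly]]) (simp_all add: \<tau> P_def pderiv_add pderiv_smult)
    show "has_partials \<eta> 0 (\<eta>z z) t z" if "\<sigma> t z \<noteq> 0"
      unfolding \<eta>z_def using that by (subst \<eta>', intro has_partials_of_z product_is_poly_deriv[OF N])
          (simp add: \<sigma>)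
  qed (use lam mu M(2) nz in \<open>simp_all add: \<sigma> \<tau> \<eta> a b H S P_def \<rho> pderiv_smult algebra_simps power2_eq_square\<close>)
  show ?thesis
  proof (rule D.hamilton_iff_compatible_finite[where \<alpha> = 0 and L = 0])
    show "S = [:- s, 1:] * \<rho>" by (rule S_def)
    show "degree \<rho> \<le> 2"
      unfolding \<rho>_def using deg by (intro degree_mult_le_sum) auto
    show "degree P \<le> 2"
      unfolding P_def using deg
      by (intro degree_add_le order_trans[OF degree_smult_le]) auto
    show "[:- s, 1:] * smult (M t) \<rho>1 = smult (poly P s) \<rho> - smult (poly \<rho> s) P"
      by (rule poly_ext) (simp add: P_def \<rho> M algebra_simps)
    show "product_is_poly \<rho> (\<eta> t) ([:- s, 1:] * \<psi>)"
      using N by (simp add: product_is_poly_def \<rho> mult.assoc left_diff_distrib)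
    show "degree ([:- s, 1:] * \<psi>) \<le> 3" using deg by (intro degree_mult_le_sum) auto
  qed (simp_all add: \<rho>)
qed

text \<open>
  As \<open>\<rho>\<^sub>1 \<eta>\<^sub>0\<close> is a polynomial, \<open>\<sigma> \<eta>\<^sub>0\<close> vanishes to order at least two at \<open>s\<close>. Hence \<open>M = \<rho>\<^sub>1(s) t\<close>, which is
  \<open>\<rho>'(s)\<close> times the residue \<open>t\<close> of \<open>\<eta>\<close>, as the motion of the pole requires.
\<close>

lemma subcase_Aq_at:
  assumes subcase: "subcase_Aq T \<sigma> \<tau> \<eta> a b H" and t: "t \<in> T"
    and lam: "lam field_differentiable at t" and mu: "mu field_differentiable at t"
    and nz: "\<sigma> t (lam t) \<noteq> 0"
  shows "hamilton_iff_compatible_at \<sigma> \<tau> \<eta> a b H lam mu t"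
proof -
  obtain s \<rho>1 \<phi> \<eta>0 R S0 M where
    \<rho>1: "\<rho>1 \<noteq> 0" and deg: "degree \<rho>1 \<le> 1" "degree \<phi> \<le> 1"
    and R: "product_is_poly \<rho>1 \<eta>0 R" "degree R \<le> 2"
    and S0: "product_is_poly ([:- s, 1:]\<^sup>2 * \<rho>1) \<eta>0 S0"
    and \<sigma>: "\<forall>t z. \<sigma> t z = (z - s)\<^sup>2 * poly \<rho>1 z"
    and \<tau>: "\<forall>t z. \<tau> t z = (z - s) * poly \<phi> z"
    and \<eta>: "\<forall>t z. \<eta> t z = t / (z - s) + \<eta>0 z"
    and "poly (pderiv S0) s \<noteq> 0 \<or> poly \<rho>1 s \<noteq> 0"
    and M: "\<forall>t. M t = poly (pderiv S0) s + poly \<rho>1 s * t" "\<forall>t\<in>T. M t \<noteq> 0"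
    and a: "\<forall>t\<in>T. \<forall>l m z. a t l m z = (l - s) * (z - s) * poly \<rho>1 z / (M t * (z - l))"
    and b: "\<forall>t\<in>T. \<forall>l m z. b t l m z = - ((l - s)\<^sup>2 * poly \<rho>1 l * m / (M t * (z - l)))"
    and H: "\<forall>t\<in>T. \<forall>l m. M t * H t l m = (l - s)\<^sup>2 * poly \<rho>1 l * m\<^sup>2
            + ((l - s) * (poly \<phi> l - poly \<rho>1 l) - (l - s)\<^sup>2 * poly (pderiv \<rho>1) l) * m
            + t / (l - s) + \<eta>0 l"
    using subcase unfolding subcase_Aq_def by (elim exE conjE) (rule that; assumption)
  note \<sigma> = \<sigma>[rule_format] and \<tau> = \<tau>[rule_format] and \<eta> = \<eta>[rule_format]
    and M = M(1)[rule_format, of t] M(2)[rule_format, OF t]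
    and a = a[rule_format, OF t] and b = b[rule_format, OF t] and H = H[rule_format, OF t]
  define \<rho> S P where "\<rho> = [:- s, 1:] * \<rho>1" and "S = [:- s, 1:] * \<rho>" and "P = [:- s, 1:] * \<phi>"
  have \<rho>: "poly \<rho> z = (z - s) * poly \<rho>1 z" "poly (pderiv \<rho>) z = poly \<rho>1 z + (z - s) * poly (pderiv \<rho>1) z" for z
    by (simp_all add: \<rho>_def pderiv_mult pderiv_pCons algebra_simps del: mult_pCons_left mult_pCons_right)
  have S: "poly S z = (z - s)\<^sup>2 * poly \<rho>1 z" for z
    by (simp add: S_def \<rho> power2_eq_square algebra_simps)
  have P: "poly P z = (z - s) * poly \<phi> z" for z
    by (simp add: P_def algebra_simps)
  have \<sigma>': "\<sigma> u = poly S" for u using \<sigma> S by auto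
  have "S0 = [:- s, 1:]\<^sup>2 * R"
    using product_is_poly_factor[OF S0 R(1)] \<rho>1 by (simp del: mult_pCons_left)
  then have "poly (pderiv S0) s = 0"
    by (simp add: pderiv_mult power2_eq_square del: mult_pCons_left mult_pCons_right)
  then have Mt: "M t = poly \<rho>1 s * t" by (simp add: M)
  define \<eta>z where "\<eta>z z = (poly (pderiv R) z - poly (pderiv \<rho>1) z * \<eta>0 z) / poly \<rho>1 z - t / (z - s)\<^sup>2" for z
  interpret D: deformation_at \<sigma> \<tau> \<eta> a b H lam mu t "M t" S 0 P 0 "smult (lam t - s) \<rho>"
    "[:- s, 1:] * pderiv \<rho>" "\<lambda>z. 1 / (z - s)" \<eta>z
  proof
    fix z
    show "has_partials \<sigma> (poly 0 z) (poly (pderiv S) z) t z"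
      by (rule has_partials_cong[OF has_partials_poly]) (simp_all add: \<sigma>')
    show "has_partials (\<lambda>u. deriv (\<sigma> u)) (poly (pderiv 0) (lam t)) (poly (pderiv (pderiv S)) (lam t)) t (lam t)"
      by (rule has_partials_cong[OF has_partials_poly]) (simp_all add: \<sigma>' deriv_poly)
    show "has_partials \<tau> (poly 0 z) (poly (pderiv P) z) t z"
      by (rule has_partials_cong[OF has_partials_poly]) (simp_all add: \<tau> P)
    show "has_partials \<eta> (1 / (z - s)) (\<eta>z z) t z" if "\<sigma> t z \<noteq> 0"
    proof -
      have z: "poly \<rho>1 z \<noteq> 0" "z - s \<noteq> 0" using that by (auto simp: \<sigma>)
      have "((\<lambda>v. 1 / (v - s)) has_field_derivative - (1 / (z - s)\<^sup>2)) (at z)"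
        using z by (auto intro!: derivative_eq_intros simp: power2_eq_square)
      from has_partials_add[OF has_partials_mult[OF has_partials_time has_partials_of_z[OF this]]
            has_partials_of_z[OF product_is_poly_deriv[OF R(1) z(1)]]]
      show ?thesis
        by (rule has_partials_cong) (simp_all add: \<eta> \<eta>z_def)
    qed
  qed (use lam mu M(2) nz in \<open>simp_all add: \<sigma> \<tau> \<eta> a b H S P \<rho> pderiv_smult algebra_simps power2_eq_square\<close>)
  show ?thesis
  proof (rule D.hamilton_iff_compatible_finite[where \<alpha> = t and L = 0])
    show "S = [:- s, 1:] * \<rho>" by (rule S_def)
    show "degree \<rho> \<le> 2"
      unfolding \<rho>_def using deg by (intro degree_mult_le_sum) auto
    show "degree P \<le> 2"
      unfolding P_def using deg by (intro degree_mult_le_sum) auto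
    show "[:- s, 1:] * smult (M t) 0 = smult (poly P s) \<rho> - smult (poly \<rho> s) P"
      by (simp add: P \<rho>)
    show "product_is_poly \<rho> \<eta>0 ([:- s, 1:] * R)"
      using R(1) by (simp add: product_is_poly_def \<rho> mult.assoc left_diff_distrib)
    show "degree ([:- s, 1:] * R) \<le> 3" using R(2) by (intro degree_mult_le_sum) auto
  qed (simp_all add: \<rho> \<eta> Mt)
qed

section \<open>Equivalence for all times\<close>

theorem theorem4p3:
  fixes T :: "complex set"
    and lam mu :: "complex \<Rightarrow> complex"
    and \<sigma> \<tau> \<eta> :: "complex \<Rightarrow> complex \<Rightarrow> complex"
    and a b :: "complex \<Rightarrow> complex \<Rightarrow> complex \<Rightarrow> complex \<Rightarrow> complex"
    and H :: "complex \<Rightarrow> complex \<Rightarrow> complex \<Rightarrow> complex"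
  assumes "open T"
    and "lam holomorphic_on T" and "mu holomorphic_on T"
    and "\<forall>t\<in>T. \<sigma> t (lam t) \<noteq> 0"
    and "subcase_A1 T \<sigma> \<tau> \<eta> a b H \<or> subcase_Ap T \<sigma> \<tau> \<eta> a b H \<or>
         subcase_Aq T \<sigma> \<tau> \<eta> a b H \<or> subcase_Bp T \<sigma> \<tau> \<eta> a b H \<or>
         subcase_Bq T \<sigma> \<tau> \<eta> a b H"
  shows "hamilton_equations T H lam mu \<longleftrightarrow>
         compatibility_conditions {(t, z). t \<in> T \<and> \<sigma> t z \<noteq> 0 \<and> z \<noteq> lam t}
           (\<lambda>t. deformed_p (\<sigma> t) (\<tau> t) (lam t))
           (\<lambda>t. deformed_q (\<sigma> t) (\<tau> t) (\<eta> t) (lam t) (mu t))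
           (\<lambda>t. a t (lam t) (mu t))
           (\<lambda>t. b t (lam t) (mu t))"
proof -
  have "hamilton_iff_compatible_at \<sigma> \<tau> \<eta> a b H lam mu t" if t: "t \<in> T" for t
  proof -
    have d: "lam field_differentiable at t" "mu field_differentiable at t" "\<sigma> t (lam t) \<noteq> 0"
      using assms(1-4) t holomorphic_on_imp_differentiable_at by blast+
    show ?thesis
      using assms(5)
      by (elim disjE) (erule subcase_A1_at[OF _ t d(1,2)] subcase_Ap_at[OF _ t d(1,2)]
            subcase_Aq_at[OF _ t d(1,2)] subcase_Bp_at[OF _ t d(1,2)] subcase_Bq_at[OF _ t d(1,2)], rule d(3))+
  qed
  then have "(\<forall>t\<in>T. hamilton_equations {t} H lam mu) \<longleftrightarrow>
    (\<forall>t\<in>T. compatibility_conditions ({t} \<times> {z. \<sigma> t z \<noteq> 0 \<and> z \<noteq> lam t})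
           (\<lambda>t. deformed_p (\<sigma> t) (\<tau> t) (lam t))
           (\<lambda>t. deformed_q (\<sigma> t) (\<tau> t) (\<eta> t) (lam t) (mu t))
           (\<lambda>t. a t (lam t) (mu t))
           (\<lambda>t. b t (lam t) (mu t)))"
    by blast
  moreover have "(\<forall>t\<in>T. hamilton_equations {t} H lam mu) \<longleftrightarrow> hamilton_equations T H lam mu"
    by (simp add: hamilton_equations_def)
  moreover have "(\<forall>t\<in>T. compatibility_conditions ({t} \<times> D t) p q a' b') \<longleftrightarrow>
    compatibility_conditions {(t, z). t \<in> T \<and> z \<in> D t} p q a' b'" for D p q a' b'
    unfolding compatibility_conditions_def by auto
  ultimately show ?thesis by simp
qed

end
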